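(* Let $n>k\geq 2$. If a central generic arrangement $\mathcal{A}^0$ of $n$ hyperplanes in $\mathbb{C}^k$ is $(r,s)$-dependent for some $s>1$, then $\mathcal{A}^0$ is non-very generic.
   Context: **Central generic arrangements and translates.** Write $[n]=\{1,\ldots,n\}$. A central generic arrangement in $\mathbb{C}^k$ is a central arrangement $\mathcal{A}^0=\{H_1^0,\ldots,H_n^0\}$ of $n>k$ hyperplanes such that, for every $m\le k$, any $m$ of the hyperplanes intersect in codimension $m$ at any point except for the origin (so any $k$ of them meet only in the origin). A translated (arrangement) of $\mathcal{A}^0$ is an arrangement $\mathcal{A}=\{H_1,\ldots,H_n\}$ of parallel translates, i.e. for each $i$ either $H_i\cap H_i^0=\emptyset$ or $H_i=H_i^0$. The space of all such $n$-tuples of translates is identified with $\mathbb{C}^n$, with $(H_1^0,\ldots,H_n^0)$ corresponding to the origin. **Discriminantal arrangement.** For $L\subset[n]$ with $|L|=k+1$, let $D_L\subset\mathbb{C}^n$ be the hyperplane of all translates $\mathcal{A}$ in which the hyperplanes $H_p$, $p\in L$, fail to form a generic arrangement, i.e. $\bigcap_{p\in L}H_p\neq\emptyset$. The discriminantal arrangement $\mathcal{B}(n,k,\mathcal{A}^0)$ is the arrangement in $\mathbb{C}^n$ of all these hyperplanes $D_L$. Its intersection lattice is the set of all intersections of the hyperplanes $D_L$. **Very generic.** There is a Zariski open set $\mathcal{Z}$ in the space of central generic arrangements of $n$ hyperplanes in $\mathbb{C}^k$ such that the intersection lattice of $\mathcal{B}(n,k,\mathcal{A})$ is independent of the choice of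 $\mathcal{A}\in\mathcal{Z}$. The arrangements in $\mathcal{Z}$ are called very generic: they are the ones for which the intersection lattice of the discriminantal arrangement has maximum cardinality among all central generic arrangements of $n$ hyperplanes in $\mathbb{C}^k$. The arrangements not in $\mathcal{Z}$ are called non-very generic. **$r$-sets.** An $r$-set is a set $\mathbb{T}=\{L_1,\ldots,L_r\}$ of subsets $L_i\subset[n]$ with $|L_i|=k+1$, such that $\bigcup_{i=1}^rL_i=\bigcup_{i\in I}L_i$ for every $I\subset[r]$ with $|I|=r-1$, and $L_i\cap L_j\neq\emptyset$ for all $1\le i<j\le r$. **$K_{\mathbb{T}}$-translated and $K_{\mathbb{T}}$-configuration.** Given an $r$-set $\mathbb{T}$, a translated $\mathcal{A}=\{H_1,\ldots,H_n\}$ of $\mathcal{A}^0$ is called $K_{\mathbb{T}}$, or $K_{\mathbb{T}}$-translated, if $\bigcap_{p\in L_i}H_p\neq\emptyset$ and $\bigcap_{p\in L_i\cup\{t\}}H_p=\emptyset$ for any $i\in[r]$ and $t\notin L_i$. The complete graph having the points $P_i=\bigcap_{p\in L_i}H_p$ as vertices and the vectors $P_iP_j$ joining $P_i$ and $P_j$ as edges is called the $K_{\mathbb{T}}$-configuration, denoted $K_{\mathbb{T}}(\mathcal{A})$. **Almost $K_{\mathbb{T}}$-translated and almost $K_{\mathbb{T}}$-configuration.** A translated $\mathcal{A}$ of $\mathcal{A}^0$ is called almost $K_{\mathbb{T}}$ (almost $K_{\mathbb{T}}$-translated) if it is $K_{\mathbb{T}}$ but for one hyperplane $H_l$ and a set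 $S_l$, i.e. if there exist a hyperplane $H_l\in\mathcal{A}$, $l\in\bigcup_{i=1}^rL_i\setminus\bigcap_{i=1}^rL_i$, and a set $S_l\subseteq\{L_i\in\mathbb{T}: l\in L_i\}$ such that $\bigcap_{p\in L_j}H_p\neq\emptyset$ for any $L_j\in\mathbb{T}\setminus S_l$ and $\bigcap_{p\in L_i}H_p=\emptyset$ for any $L_i\in S_l$. Putting $P_i=\bigcap_{p\in L_i\setminus\{l\}}H_p$ for $L_i\in S_l$ and $P_i=\bigcap_{p\in L_i}H_p$ for $L_i\notin S_l$, the complete graph having the $P_i$ as vertices and the $P_iP_j$ as edges is called the almost $K_{\mathbb{T}}$-configuration, denoted $K_{\mathbb{T}\setminus S_l}(\mathcal{A})$. **$(r,s)$-dependency.** A central generic arrangement $\mathcal{A}^0$ of $n$ hyperplanes in $\mathbb{C}^k$ is called $(r,s)$-dependent if there exist an $r$-set $\mathbb{T}=\{L_1,\ldots,L_r\}$, an index $l\in\bigcup_{i=1}^rL_i\setminus\bigcap_{i=1}^rL_i$ and a subset $S_l\subseteq\{L_i\in\mathbb{T}: l\in L_i\}$ with $|S_l|=s$, such that any almost $K_{\mathbb{T}}$-configuration $K_{\mathbb{T}\setminus S_l}(\mathcal{A})$ gives rise to a $K_{\mathbb{T}}$-configuration $K_{\mathbb{T}}(\mathcal{A}')$ with the $K_{\mathbb{T}}$-translated $\mathcal{A}'$ obtained from the almost $K_{\mathbb{T}}$-translated $\mathcal{A}$ by a suitable translation of the hyperplane $H_l\in\mathcal{A}$.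
   Formalization: In (r,s)-dependency, at least one almost K_T-configuration must exist (else all arrangements with n ≥ k+2 are vacuously dependent), and almost K_T-configurations keep K_T's non-incidence conditions: no vertex on a further hyperplane, nor on H_l once moved to S_l's vertices. *)

theory Defs
  imports "HOL-Analysis.Analysis"
begin

text \<open>
  An arrangement of \<open>n = CARD('n)\<close> hyperplanes in \<open>\<complex>\<^sup>k\<close>, \<open>k = CARD('k)\<close>, is given by the matrix
  \<open>A\<close> whose rows are normal vectors; the finite type \<open>'n\<close> plays the role of \<open>[n]\<close>.  A point
  \<open>t\<close> of \<open>\<complex>\<^sup>n\<close> is the translate in which the \<open>i\<close>-th hyperplane has equation
  \<open>\<Sum>j. A\<^sub>i\<^sub>j x\<^sub>j = t\<^sub>i\<close>, with \<open>t = 0\<close> the central arrangement.  Rescaling the rows of \<open>A\<close>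
  only rescales the coordinates of \<open>t\<close>.
\<close>

definition hyp :: "complex^'k^'n \<Rightarrow> complex^'n \<Rightarrow> 'n \<Rightarrow> (complex^'k) set" where
  "hyp A t i = {x. (A *v x) $ i = t $ i}"

text \<open>The dimension \<open>vec.dim\<close> is the one over \<open>\<complex>\<close>.  The case \<open>card I = 1\<close> says that each
  \<open>hyp A 0 i\<close> is indeed a hyperplane.\<close>

definition central_generic :: "complex^'k^'n \<Rightarrow> bool" where
  "central_generic A \<longleftrightarrow>
     (\<forall>I. card I \<le> CARD('k) \<longrightarrow> vec.dim (\<Inter>i\<in>I. hyp A 0 i) = CARD('k) - card I)"

definition D_hyp :: "complex^'k^'n \<Rightarrow> 'n set \<Rightarrow> (complex^'n) set" where
  "D_hyp A L = {t. (\<Inter>p\<in>L. hyp A t p) \<noteq> {}}"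

definition discriminantal :: "complex^'k^'n \<Rightarrow> (complex^'n) set set" where
  "discriminantal A = {D_hyp A L | L. card L = CARD('k) + 1}"

text \<open>The empty intersection \<open>\<Inter>{} = UNIV\<close> is the ambient space \<open>\<complex>\<^sup>n\<close>.\<close>

definition intersection_lattice :: "complex^'k^'n \<Rightarrow> (complex^'n) set set" where
  "intersection_lattice A = {\<Inter>F | F. F \<subseteq> discriminantal A}"

definition very_generic :: "complex^'k^'n \<Rightarrow> bool" where
  "very_generic A \<longleftrightarrow> central_generic A \<and>
     (\<forall>B :: complex^'k^'n. central_generic B \<longrightarrow>
        card (intersection_lattice B) \<le> card (intersection_lattice A))"

definition r_set :: "'k itself \<Rightarrow> nat \<Rightarrow> 'n::finite set set \<Rightarrow> bool" where
  "r_set _ r T \<longleftrightarrow> card T = r \<and> (\<forall>L\<in>T. card L = CARD('k) + 1) \<and>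
     (\<forall>I. I \<subseteq> T \<and> card I + 1 = r \<longrightarrow> \<Union>T = \<Union>I) \<and>
     (\<forall>L\<in>T. \<forall>M\<in>T. L \<noteq> M \<longrightarrow> L \<inter> M \<noteq> {})"

definition K_translated :: "complex^'k^'n \<Rightarrow> 'n set set \<Rightarrow> complex^'n \<Rightarrow> bool" where
  "K_translated A T t \<longleftrightarrow>
     (\<forall>L\<in>T. (\<Inter>p\<in>L. hyp A t p) \<noteq> {} \<and> (\<forall>h. h \<notin> L \<longrightarrow> (\<Inter>p\<in>insert h L. hyp A t p) = {}))"

definition almost_K_translated ::
  "complex^'k^'n \<Rightarrow> 'n set set \<Rightarrow> 'n \<Rightarrow> 'n set set \<Rightarrow> complex^'n \<Rightarrow> bool" where
  "almost_K_translated A T l S t \<longleftrightarrow>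
     (\<forall>L\<in>T - S. (\<Inter>p\<in>L. hyp A t p) \<noteq> {}) \<and> (\<forall>L\<in>S. (\<Inter>p\<in>L. hyp A t p) = {})"

text \<open>The vertex \<open>P\<^sub>i\<close> attached to \<open>L = L\<^sub>i\<close>, as the (singleton) set of common points of the
  hyperplanes defining it.\<close>

definition vertex ::
  "complex^'k^'n \<Rightarrow> 'n \<Rightarrow> 'n set set \<Rightarrow> complex^'n \<Rightarrow> 'n set \<Rightarrow> (complex^'k) set" where
  "vertex A l S t L = (\<Inter>p\<in>(if L \<in> S then L - {l} else L). hyp A t p)"

text \<open>
  An almost \<open>K\<^sub>T\<close>-translated is ``\<open>K\<^sub>T\<close> but for \<open>H\<^sub>l\<close> and \<open>S\<^sub>l\<close>'': the non-incidences that
  being \<open>K\<^sub>T\<close> demands of the vertices are kept.  So no vertex lies on a further hyperplane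
  \<open>H\<^sub>h\<close>, \<open>h \<noteq> l\<close>; and as \<open>H\<^sub>l\<close> is still to be translated onto the vertices of \<open>S\<^sub>l\<close>, for
  \<open>h = l\<close> this is read as: no translate of \<open>H\<^sub>l\<close> passes both through a vertex of \<open>S\<^sub>l\<close> and
  through a vertex \<open>P\<^sub>j\<close> with \<open>l \<notin> L\<^sub>j\<close>.  Without these conditions the central arrangement with
  only \<open>H\<^sub>l\<close> moved off the origin would count whenever \<open>S\<^sub>l = {L\<^sub>i. l \<in> L\<^sub>i}\<close>, and no
  translation of \<open>H\<^sub>l\<close> makes it \<open>K\<^sub>T\<close>.  The vector \<open>t + axis l c\<close> is the translate obtained
  from \<open>t\<close> by moving \<open>H\<^sub>l\<close> only.
\<close>

definition almost_K_configuration ::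
  "complex^'k^'n \<Rightarrow> 'n set set \<Rightarrow> 'n \<Rightarrow> 'n set set \<Rightarrow> complex^'n \<Rightarrow> bool" where
  "almost_K_configuration A T l S t \<longleftrightarrow>
     almost_K_translated A T l S t \<and>
     (\<forall>L\<in>T. \<forall>h. h \<notin> L \<and> h \<noteq> l \<longrightarrow> vertex A l S t L \<inter> hyp A t h = {}) \<and>
     (\<forall>L\<in>S. \<forall>M\<in>T. l \<notin> M \<longrightarrow>
        (\<forall>c. vertex A l S t L \<inter> hyp A (t + axis l c) l = {} \<or>
             vertex A l S t M \<inter> hyp A (t + axis l c) l = {}))"

text \<open>Almost \<open>K\<^sub>T\<close>-configurations are required to exist.  Otherwise, for \<open>n \<ge> k + 2\<close>, taking
  for \<open>T\<close> all \<open>(k+1)\<close>-subsets of a \<open>(k+2)\<close>-set would make every arrangement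
  \<open>(k + 2, 2)\<close>-dependent: two of the conditions \<open>D\<^sub>L\<close> already imply all the others.\<close>

definition dependent_arr :: "complex^'k^'n \<Rightarrow> nat \<Rightarrow> nat \<Rightarrow> bool" where
  "dependent_arr A r s \<longleftrightarrow>
     (\<exists>T l S. r_set TYPE('k) r T \<and> l \<in> \<Union>T - \<Inter>T \<and> S \<subseteq> {L \<in> T. l \<in> L} \<and> card S = s \<and>
        (\<exists>t. almost_K_configuration A T l S t) \<and>
        (\<forall>t. almost_K_configuration A T l S t \<longrightarrow> (\<exists>c. K_translated A T (t + axis l c))))"

end

theory Submission
  imports Defs "HOL-Computational_Algebra.Polynomial"
begin

text \<open>
  Every \<open>D\<^sub>L\<close> is the kernel of a linear form on \<open>\<complex>\<^sup>n\<close>, given by a vector \<open>circuit A L\<close> with support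
  \<open>L\<close>: the unique linear relation, up to scaling, among the \<open>k + 1\<close> normal vectors indexed by \<open>L\<close>.
  The intersection lattice is therefore the lattice of flats of the matroid of these vectors, and
  the proof compares the matroids of different arrangements.

  \<^item> More independent sets give more flats (\<open>card_common_kernels_less\<close>).  If every set of circuits
    that is independent for \<open>A\<close> is independent for \<open>A'\<close>, then a flat of \<open>A\<close> lifts to the flat of
    \<open>A'\<close> spanned by a basis of it, and the lift is injective.  If moreover some set is independent
    only for \<open>A'\<close>, the lift is not onto: for a minimal such set \<open>C\<close>, all the sets \<open>C - {g}\<close> span
    one flat of \<open>A\<close> but different flats of \<open>A'\<close>.

  \<^item> Dependency yields dependent circuits (\<open>dependent_arr_dependent_circuits\<close>).  If the circuits of
    the sets in \<open>T\<close> were independent, an almost \<open>K\<^sub>T\<close>-configuration could be deformed so that only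
    the value of one form, with index \<open>L1\<close> in \<open>S\<close>, changes.  The translation of the hyperplane \<open>l\<close>
    that repairs \<open>L1\<close> would then no longer repair a second member of \<open>S\<close>; this is where \<open>s > 1\<close>
    enters.

  \<^item> The dependency is accidental.  Let \<open>C \<subseteq> T\<close> be minimal dependent.  A set of circuits inside \<open>W\<close>
    spans a space of dimension at most \<open>card W - k\<close>.  If \<open>\<Union>C\<close> had fewer than \<open>card C + k\<close>
    elements, the circuits of \<open>C\<close> would span all relations inside \<open>\<Union>C\<close>, and all hyperplanes in
    \<open>\<Union>C\<close> of a \<open>K\<^sub>T\<close>-translate would pass through one point, contrary to the maximality of its
    vertices (\<open>surplus_minimal_dependent\<close>).  So every nonempty \<open>G \<subseteq> C\<close> satisfies the surplus form
    \<open>card G + k \<le> card (\<Union>G)\<close> of Hall's condition.  This condition suffices for the existence of a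
    matrix with independent relations (\<open>independent_relations_exist\<close>), by a greedy choice of
    generic vectors.

  \<^item> A generic point of the complex line through \<open>A\<close> and that matrix is a central generic
    arrangement that keeps all independent sets of \<open>A\<close> and makes \<open>C\<close> independent as well
    (\<open>generic_perturbation\<close>).  Its intersection lattice is therefore strictly larger.
\<close>

section \<open>Linear forms and independent families\<close>

text \<open>
  The bilinear and not the Hermitian product: vectors serve as linear forms.
\<close>

definition pairing :: "complex^'n \<Rightarrow> complex^'n \<Rightarrow> complex" where
  "pairing c t = (\<Sum>p\<in>UNIV. c $ p * t $ p)"

lemma pairing_simps [simp]:
  "pairing 0 t = 0" "pairing c 0 = 0"
  "pairing (c + d) t = pairing c t + pairing d t"
  "pairing c (t + u) = pairing c t + pairing c u"
  "pairing (a *s c) t = a * pairing c t"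
  "pairing c (a *s t) = a * pairing c t"
  by (simp_all add: pairing_def algebra_simps sum.distrib sum_distrib_left)

lemma pairing_sum: "pairing (\<Sum>i\<in>I. f i) t = (\<Sum>i\<in>I. pairing (f i) t)"
  by (induction I rule: infinite_finite_induct) simp_all

lemma pairing_axis [simp]: "pairing c (axis l a) = c $ l * a"
  by (simp add: pairing_def axis_def if_distrib cong: if_cong)

text \<open>
  Independence is a property of the family and not of its image: a repeated vector counts as a
  dependency.
\<close>

definition indep_family :: "('i \<Rightarrow> complex^'n) \<Rightarrow> 'i set \<Rightarrow> bool" where
  "indep_family a F \<longleftrightarrow> finite F \<and> (\<forall>c. (\<Sum>i\<in>F. c i *s a i) = 0 \<longrightarrow> (\<forall>i\<in>F. c i = 0))"

definition common_kernel :: "('i \<Rightarrow> complex^'n) \<Rightarrow> 'i set \<Rightarrow> (complex^'n) set" where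
  "common_kernel a F = {t. \<forall>i\<in>F. pairing (a i) t = 0}"

lemma indep_family_subset:
  assumes "indep_family a F" "G \<subseteq> F" shows "indep_family a G"
  unfolding indep_family_def
proof (intro conjI allI impI ballI)
  show "finite G" using assms finite_subset by (auto simp: indep_family_def)
  fix c i assume c: "(\<Sum>i\<in>G. c i *s a i) = 0" and i: "i \<in> G"
  have "(\<Sum>i\<in>F. (if i \<in> G then c i else 0) *s a i) = (\<Sum>i\<in>G. c i *s a i)"
    using assms by (intro sum.mono_neutral_cong_right) (auto simp: indep_family_def)
  then have "\<forall>i\<in>F. (if i \<in> G then c i else 0) = 0"
    using assms(1) c unfolding indep_family_def by fastforce
  then show "c i = 0" using i assms(2) by fastforce
qed

lemma indep_family_inj_on:
  assumes "indep_family a F" shows "inj_on a F"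
proof (rule inj_onI, rule ccontr)
  fix i j assume ij: "i \<in> F" "j \<in> F" "a i = a j" "i \<noteq> j"
  then have ind: "indep_family a {i, j}" using indep_family_subset[OF assms, of "{i, j}"] by blast
  define c :: "'a \<Rightarrow> complex" where "c m = (if m = i then 1 else -1)" for m
  have "(\<Sum>m\<in>{i, j}. c m *s a m) = 0"
    using ij(3,4) by (simp add: c_def vector_scalar_mult_def vec_eq_iff)
  then have "c i = 0" using ind unfolding indep_family_def by blast
  then show False by (simp add: c_def)
qed

lemma indep_family_iff_independent:
  "indep_family a F \<longleftrightarrow> finite F \<and> inj_on a F \<and> vec.independent (a ` F)"
proof (cases "finite F \<and> inj_on a F")
  case True
  show ?thesis
  proof
    assume ind: "indep_family a F"
    have "\<forall>v\<in>a ` F. c v = 0" if "(\<Sum>v\<in>a ` F. c v *s v) = 0" for c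
      using that True ind by (auto simp: indep_family_def sum.reindex)
    then show "finite F \<and> inj_on a F \<and> vec.independent (a ` F)"
      using True by (simp add: vec.independent_explicit)
  next
    assume "finite F \<and> inj_on a F \<and> vec.independent (a ` F)"
    then have ind: "(\<Sum>v\<in>a ` F. c v *s v) = 0 \<Longrightarrow> v \<in> a ` F \<Longrightarrow> c v = 0" for c v
      using vec.independent_explicit by blast
    show "indep_family a F" unfolding indep_family_def
    proof (intro conjI allI impI ballI)
      fix c i assume c: "(\<Sum>i\<in>F. c i *s a i) = 0" and i: "i \<in> F"
      have "(\<Sum>v\<in>a ` F. c (the_inv_into F a v) *s v) = 0"
        using True c by (simp add: sum.reindex the_inv_into_f_f)
      from ind[OF this, of "a i"] show "c i = 0" using i True by (simp add: the_inv_into_f_f)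
    qed (use True in auto)
  qed
next
  case False
  then show ?thesis using indep_family_inj_on by (auto simp: indep_family_def)
qed

text \<open>
  A spanning set as small as the dimension has neither repetitions nor dependencies.
\<close>

lemma indep_family_if_dim:
  assumes "finite F" "vec.dim (a ` F) = card F"
  shows "indep_family a F"
proof -
  have "vec.dim (a ` F) \<le> card (a ` F)"
    by (rule vec.dim_le_card[OF vec.span_superset]) (simp add: assms)
  moreover have "card (a ` F) \<le> card F" by (rule card_image_le[OF assms(1)])
  ultimately have c: "card (a ` F) = card F" using assms(2) by simp
  have "inj_on a F" by (rule eq_card_imp_inj_on[OF assms(1) c])
  moreover have "vec.independent (a ` F)"
    using vec.card_eq_dim[of "a ` F" "a ` F", OF subset_refl] c assms vec.span_superset[of "a ` F"]
    by (metis finite_imageI)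
  ultimately show ?thesis using assms indep_family_iff_independent by blast
qed

lemma indep_family_nonzero:
  assumes "indep_family a F" "i \<in> F" shows "a i \<noteq> 0"
proof
  assume "a i = 0"
  then have "vec.dependent (a ` F)" using assms(2) by (metis vec.dependent_zero imageI)
  then show False using assms(1) by (simp add: indep_family_iff_independent)
qed

text \<open>
  An independent family extends to a basis, and the dual basis consists of pairings with vectors.
\<close>

lemma dual_vector_exists:
  assumes "indep_family a F" "e \<in> F"
  shows "\<exists>t. t \<in> common_kernel a (F - {e}) \<and> pairing (a e) t = 1"
proof -
  have inj: "inj_on a F" and ind: "vec.independent (a ` F)"
    using assms by (auto simp: indep_family_iff_independent)
  define w :: "complex^'b \<Rightarrow> complex^'b" where "w v = (if v = a e then 1 else 0)" for v
  obtain g :: "complex^'b \<Rightarrow> complex^'b" where g: "Vector_Spaces.linear (*s) (*s) g"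
    and gw: "\<forall>x\<in>a ` F. g x = w x"
    using vec.linear_independent_extend[OF ind] by blast
  \<comment> \<open>A form is needed and not a linear map, so one arbitrary coordinate is read off.\<close>
  define i0 :: 'b where "i0 = undefined"
  define t where "t = matrix g $ i0"
  have p: "pairing v t = g v $ i0" for v
    unfolding matrix_works[OF g, of v, symmetric] t_def pairing_def
    by (simp add: matrix_vector_mult_def mult.commute)
  have "pairing (a f) t = 0" if "f \<in> F - {e}" for f
  proof -
    have "a f \<noteq> a e" using that assms(2) inj by (auto dest: inj_onD)
    then show ?thesis using gw that by (simp add: p w_def)
  qed
  moreover have "pairing (a e) t = 1" using gw assms(2) by (simp add: p w_def)
  ultimately show ?thesis by (auto simp: common_kernel_def)
qed

lemma common_kernel_dependent:
  assumes ind: "indep_family a I" and dep: "\<not> indep_family a (insert e I)" and t: "t \<in> common_kernel a I"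
  shows "pairing (a e) t = 0"
proof (cases "e \<in> I")
  case True
  then show ?thesis using t by (auto simp: common_kernel_def)
next
  case False
  have fin: "finite I" using ind by (simp add: indep_family_def)
  then obtain c where c: "(\<Sum>i\<in>insert e I. c i *s a i) = 0" "\<exists>i\<in>insert e I. c i \<noteq> 0"
    using dep by (auto simp: indep_family_def)
  have eq: "c e *s a e + (\<Sum>i\<in>I. c i *s a i) = 0" using c(1) fin False by simp
  \<comment> \<open>A relation that avoids the new vector would be a relation in the independent family.\<close>
  have "c e \<noteq> 0"
  proof
    assume "c e = 0"
    then have "(\<Sum>i\<in>I. c i *s a i) = 0" using eq by simp
    then have "\<forall>i\<in>I. c i = 0" using ind unfolding indep_family_def by blast
    then show False using c(2) \<open>c e = 0\<close> by blast
  qed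
  have "pairing (c e *s a e + (\<Sum>i\<in>I. c i *s a i)) t = 0" by (simp only: eq pairing_simps)
  then have "c e * pairing (a e) t + (\<Sum>i\<in>I. c i * pairing (a i) t) = 0"
    by (simp add: pairing_sum)
  moreover have "(\<Sum>i\<in>I. c i * pairing (a i) t) = 0"
    using t by (intro sum.neutral) (auto simp: common_kernel_def)
  ultimately show ?thesis using \<open>c e \<noteq> 0\<close> by simp
qed

lemma common_kernel_basis_exists:
  assumes "finite F"
  shows "\<exists>I\<subseteq>F. indep_family a I \<and> common_kernel a I = common_kernel a F"
  using assms
proof (induction F rule: finite_induct)
  case empty
  then show ?case by (auto simp: indep_family_def)
next
  case (insert e F)
  then obtain I where I: "I \<subseteq> F" "indep_family a I" "common_kernel a I = common_kernel a F" by blast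
  show ?case
  proof (cases "indep_family a (insert e I)")
    case True
    have "common_kernel a (insert e I) = common_kernel a (insert e F)"
      using I(3) by (auto simp: common_kernel_def set_eq_iff)
    then show ?thesis using True I(1) by blast
  next
    case False
    have "common_kernel a (insert e F) = common_kernel a F"
      using common_kernel_dependent[OF I(2) False] I(3) by (auto simp: common_kernel_def)
    then show ?thesis using I by blast
  qed
qed

lemma minimal_dependent_subset:
  assumes "finite F" "\<not> indep_family a F"
  shows "\<exists>C\<subseteq>F. \<not> indep_family a C \<and> (\<forall>G. G \<subset> C \<longrightarrow> indep_family a G)"
  using assms
proof (induction F rule: finite_psubset_induct)
  case (psubset F)
  show ?case
  proof (cases "\<exists>G. G \<subset> F \<and> \<not> indep_family a G")
    case True
    then obtain G where "G \<subset> F" "\<not> indep_family a G" by blast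
    from psubset.IH[OF this] obtain C where
      "C \<subseteq> G" "\<not> indep_family a C \<and> (\<forall>G'. G' \<subset> C \<longrightarrow> indep_family a G')" by blast
    moreover have "C \<subseteq> F" using \<open>C \<subseteq> G\<close> \<open>G \<subset> F\<close> by simp
    ultimately show ?thesis by (intro exI[of _ C]) simp
  next
    case False
    then show ?thesis using psubset.prems by (intro exI[of _ F]) simp
  qed
qed

lemma card_dependent_ge_2:
  assumes "\<not> indep_family a C" "finite C"
    and "\<And>e. e \<in> C \<Longrightarrow> a e \<noteq> 0"
  shows "card C \<ge> 2"
proof (rule ccontr)
  assume "\<not> card C \<ge> 2"
  then have "card C = 0 \<or> card C = 1" by linarith
  then consider "C = {}" | e where "C = {e}" using assms(2) by (auto simp: card_1_singleton_iff)
  then show False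
  proof cases
    case (2 e)
    then show False using assms(1,3) by (auto simp: indep_family_def)
  qed (use assms(1) in \<open>auto simp: indep_family_def\<close>)
qed

section \<open>Fewer dependencies give more flats\<close>

text \<open>
  Common kernels of \<open>b\<close> determine those of \<open>a\<close> on \<open>a\<close>-independent sets: an element \<open>e\<close> whose form
  vanishes on the common kernel for \<open>b\<close> is \<open>b\<close>-dependent on \<open>I\<close>, hence also \<open>a\<close>-dependent on \<open>I\<close>.
\<close>

lemma common_kernel_transfer:
  assumes weak: "\<And>F. F \<subseteq> E \<Longrightarrow> indep_family a F \<Longrightarrow> indep_family b F"
    and "I \<subseteq> E" "J \<subseteq> E" "indep_family a I" "common_kernel b I \<subseteq> common_kernel b J"
  shows "common_kernel a I \<subseteq> common_kernel a J"
proof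
  fix t assume t: "t \<in> common_kernel a I"
  have "pairing (a e) t = 0" if e: "e \<in> J" for e
  proof (cases "e \<in> I")
    case True
    then show ?thesis using t by (auto simp: common_kernel_def)
  next
    case False
    have "\<not> indep_family b (insert e I)"
    proof
      assume "indep_family b (insert e I)"
      from dual_vector_exists[OF this insertI1]
      obtain u where "u \<in> common_kernel b (insert e I - {e})" "pairing (b e) u = 1" by blast
      moreover have "insert e I - {e} = I" using False by blast
      ultimately show False using assms(5) e by (auto simp: common_kernel_def)
    qed
    moreover have "insert e I \<subseteq> E" using assms(2,3) e by blast
    ultimately have "\<not> indep_family a (insert e I)" using weak by metis
    then show ?thesis by (rule common_kernel_dependent[OF assms(4) _ t])
  qed
  then show "t \<in> common_kernel a J" by (auto simp: common_kernel_def)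
qed

text \<open>
  Common kernels correspond to flats, with the inclusion reversed.  For a flat of \<open>a\<close>, the common
  kernel for \<open>b\<close> of one of its bases recovers the flat.  Two sets \<open>C - {e}\<close> and \<open>C - {f}\<close>, with \<open>C\<close>
  minimal dependent for \<open>a\<close> and independent for \<open>b\<close>, are bases of the same flat of \<open>a\<close> but of
  different flats of \<open>b\<close>, so that one of these two flats of \<open>b\<close> is missed.
\<close>

lemma card_common_kernels_less:
  fixes a b :: "'i \<Rightarrow> complex^'n"
  assumes fin: "finite E"
    and weak: "\<And>F. F \<subseteq> E \<Longrightarrow> indep_family a F \<Longrightarrow> indep_family b F"
    and nz: "\<And>e. e \<in> E \<Longrightarrow> a e \<noteq> 0"
    and F: "F \<subseteq> E" "indep_family b F" "\<not> indep_family a F"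
  shows "card (common_kernel a ` Pow E) < card (common_kernel b ` Pow E)"
proof -
  obtain C where C: "C \<subseteq> F" "\<not> indep_family a C" "\<forall>G. G \<subset> C \<longrightarrow> indep_family a G"
    using minimal_dependent_subset[OF finite_subset[OF F(1) fin] F(3)] by blast
  have CE: "C \<subseteq> E" using C(1) F(1) by (rule subset_trans)
  have finC: "finite C" using CE fin by (rule finite_subset)
  have "card C \<ge> 2"
    by (rule card_dependent_ge_2[OF C(2) finC nz]) (use CE in blast)
  then obtain e f where ef: "e \<in> C" "f \<in> C" "e \<noteq> f"
    using card_le_Suc0_iff_eq[OF finC] by fastforce
  define basis where
    "basis X = (SOME I. I \<subseteq> E \<and> indep_family a I \<and> common_kernel a I = X)" for X
  have basis: "basis X \<subseteq> E" "indep_family a (basis X)" "common_kernel a (basis X) = X"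
    if "X \<in> common_kernel a ` Pow E" for X
  proof -
    obtain G where G: "G \<subseteq> E" "X = common_kernel a G" using \<open>X \<in> _\<close> by blast
    obtain I where "I \<subseteq> G" "indep_family a I" "common_kernel a I = common_kernel a G"
      using common_kernel_basis_exists[OF finite_subset[OF G(1) fin], of a] by blast
    then have "\<exists>I. I \<subseteq> E \<and> indep_family a I \<and> common_kernel a I = X"
      using G by (intro exI[of _ I]) simp
    from someI_ex[OF this]
    show "basis X \<subseteq> E" "indep_family a (basis X)" "common_kernel a (basis X) = X"
      by (auto simp: basis_def)
  qed
  define lift where "lift X = common_kernel b (basis X)" for X
  have eq: "common_kernel a I = X"
    if "X \<in> common_kernel a ` Pow E" "I \<subseteq> E" "indep_family a I" "common_kernel b I = lift X" for I X
  proof -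
    note basisX = basis[OF that(1)]
    have "common_kernel a I \<subseteq> common_kernel a (basis X)"
      by (rule common_kernel_transfer[of E a b])
        (use weak that(2-4) basisX in \<open>simp_all add: lift_def\<close>)
    moreover have "common_kernel a (basis X) \<subseteq> common_kernel a I"
      by (rule common_kernel_transfer[of E a b])
        (use weak that(2-4) basisX in \<open>simp_all add: lift_def\<close>)
    ultimately show ?thesis using basisX(3) by simp
  qed
  have inj: "inj_on lift (common_kernel a ` Pow E)"
  proof (rule inj_onI)
    fix X Y assume X: "X \<in> common_kernel a ` Pow E" and Y: "Y \<in> common_kernel a ` Pow E"
      and "lift X = lift Y"
    then have "common_kernel a (basis X) = Y"
      using eq[OF Y] basis(1,2)[OF X] by (simp add: lift_def)
    then show "X = Y" using basis(3)[OF X] by simp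
  qed
  have sub: "lift ` (common_kernel a ` Pow E) \<subseteq> common_kernel b ` Pow E"
    using basis(1) by (force simp: lift_def)
  have "\<not> common_kernel b ` Pow E \<subseteq> lift ` (common_kernel a ` Pow E)"
  proof
    assume sup: "common_kernel b ` Pow E \<subseteq> lift ` (common_kernel a ` Pow E)"
    have drop: "\<exists>X \<in> common_kernel a ` Pow E. common_kernel b (C - {g}) = lift X \<and> X = common_kernel a C"
      if g: "g \<in> C" for g
    proof -
      have ind: "indep_family a (C - {g})" using C(3) g by blast
      have "common_kernel b (C - {g}) \<in> common_kernel b ` Pow E" using CE by blast
      then have "common_kernel b (C - {g}) \<in> lift ` (common_kernel a ` Pow E)" using sup by blast
      then obtain X where X: "X \<in> common_kernel a ` Pow E" "common_kernel b (C - {g}) = lift X" by blast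
      have "common_kernel a (C - {g}) = X" using eq[OF X(1) _ ind X(2)] CE by blast
      moreover have "insert g (C - {g}) = C" using g by blast
      then have "common_kernel a (C - {g}) \<subseteq> common_kernel a C"
        using common_kernel_dependent[OF ind, of g] C(2) by (fastforce simp: common_kernel_def)
      then have "common_kernel a (C - {g}) = common_kernel a C" by (auto simp: common_kernel_def)
      ultimately show ?thesis using X by blast
    qed
    have "common_kernel b (C - {e}) = common_kernel b (C - {f})"
      using drop[OF ef(1)] drop[OF ef(2)] by auto
    moreover obtain t where "t \<in> common_kernel b (C - {e})" "pairing (b e) t = 1"
      using dual_vector_exists[OF indep_family_subset[OF F(2) C(1)] ef(1)] by blast
    ultimately show False using ef by (auto simp: common_kernel_def)
  qed
  then have "lift ` (common_kernel a ` Pow E) \<subset> common_kernel b ` Pow E" using sub by blast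
  then have "card (lift ` (common_kernel a ` Pow E)) < card (common_kernel b ` Pow E)"
    using fin by (intro psubset_card_mono) auto
  then show ?thesis using card_image[OF inj] by simp
qed

section \<open>Generic choices over an infinite field\<close>

lemma finite_affine_zeros: "a \<noteq> 0 \<Longrightarrow> finite {e::complex. a + e * b = 0}"
proof -
  assume "a \<noteq> 0"
  then have "e = - a / b" if "a + e * b = 0" for e
  proof -
    have "b \<noteq> 0" using that \<open>a \<noteq> 0\<close> by auto
    moreover have "e * b = - a" using that by (simp add: eq_neg_iff_add_eq_0 add.commute)
    ultimately show ?thesis by (rule nonzero_eq_divide_eq[THEN iffD2])
  qed
  then have "{e. a + e * b = 0} \<subseteq> {- a / b}" by blast
  then show ?thesis by (rule finite_subset) simp
qed

lemma det_pencil_polynomial: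
  fixes M N :: "complex^'m^'m"
  shows "\<exists>p. \<forall>z. poly p z = det (\<chi> i j. M $ i $ j + z * N $ i $ j)"
proof (intro exI allI)
  fix z
  show "poly (\<Sum>\<sigma>\<in>{\<sigma>. \<sigma> permutes (UNIV::'m set)}.
      [:of_int (sign \<sigma>):] * (\<Prod>i\<in>UNIV. [:M $ i $ \<sigma> i, N $ i $ \<sigma> i:])) z
    = det (\<chi> i j. M $ i $ j + z * N $ i $ j)"
    by (simp add: det_def poly_sum poly_prod)
qed

text \<open>
  Injectivity is an open condition on a pencil of linear maps, in the Zariski sense: a left inverse
  of the map at parameter \<open>0\<close> turns the pencil into \<open>1 + z K\<close>, whose determinant is a polynomial
  in \<open>z\<close> with value \<open>1\<close> at \<open>0\<close>.
\<close>

lemma finite_degenerate_parameters: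
  fixes M N :: "complex^'m^'p"
  assumes V: "vec.subspace V" and inj: "\<And>v. v \<in> V \<Longrightarrow> M *v v = 0 \<Longrightarrow> v = 0"
  shows "finite {z. \<exists>v\<in>V. v \<noteq> 0 \<and> M *v v + z *s (N *v v) = 0}"
proof -
  have "inj_on ((*v) M) V"
  proof (rule inj_onI)
    fix v w assume vw: "v \<in> V" "w \<in> V" "M *v v = M *v w"
    then have "v - w = 0"
      by (intro inj) (auto simp: vec.subspace_diff[OF V] matrix_vector_mult_diff_distrib)
    then show "v = w" by simp
  qed
  from vec.linear_exists_left_inverse_on[OF matrix_vector_mul_linear_gen V this]
  obtain g where g: "Vector_Spaces.linear (*s) (*s) g" "\<And>v. v \<in> V \<Longrightarrow> g (M *v v) = v"
    by blast
  define K where "K = matrix g ** N"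
  obtain p where p: "\<And>z. poly p z = det (\<chi> i j. mat 1 $ i $ j + z * K $ i $ j)"
    using det_pencil_polynomial[of "mat 1" K] by blast
  have "(\<chi> i j. mat 1 $ i $ j + 0 * K $ i $ j) = mat 1" by (simp add: vec_eq_iff)
  then have "poly p 0 \<noteq> 0" by (simp add: p)
  then have "finite {z. poly p z = 0}" by (intro poly_roots_finite) auto
  moreover have "poly p z = 0" if v: "v \<in> V" "v \<noteq> 0" "M *v v + z *s (N *v v) = 0" for z v
  proof -
    let ?D = "\<chi> i j. mat 1 $ i $ j + z * K $ i $ j"
    have "matrix g *v (M *v v + z *s (N *v v)) = 0" using v(3) by simp
    then have "g (M *v v) + z *s (K *v v) = 0"
      by (simp add: matrix_works[OF g(1), symmetric] K_def matrix_vector_right_distrib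
          matrix_vector_mul_assoc vector_scalar_commute)
    moreover have "?D *v v = v + z *s (K *v v)"
    proof -
      have "?D = mat 1 + (\<chi> i j. z * K $ i $ j)" by (simp add: vec_eq_iff)
      moreover have "(\<chi> i j. z * K $ i $ j) *v v = z *s (K *v v)"
        by (simp add: vec_eq_iff matrix_vector_mult_def sum_distrib_left mult.assoc)
      ultimately show ?thesis by (simp add: matrix_vector_mult_add_rdistrib)
    qed
    ultimately have "?D *v v = 0" using g(2)[OF v(1)] by simp
    then have "\<not> (\<exists>B. B ** ?D = mat 1)"
      using v(2) unfolding matrix_left_invertible_ker by blast
    then have "\<not> invertible ?D" by (auto simp: invertible_def)
    then have "det ?D = 0" unfolding invertible_det_nz by simp
    then show ?thesis by (simp only: p)
  qed
  ultimately show ?thesis by (elim rev_finite_subset) blast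
qed

text \<open>
  A vector space over an infinite field is not a finite union of proper subspaces: each subspace
  meets a line \<open>x + c y\<close> that it does not contain in at most one point.
\<close>

lemma avoid_finitely_many_subspaces:
  fixes W :: "(complex^'n) set"
  assumes "finite \<Y>" and W: "vec.subspace W"
    and "\<And>Y. Y \<in> \<Y> \<Longrightarrow> vec.subspace Y" "\<And>Y. Y \<in> \<Y> \<Longrightarrow> \<not> W \<subseteq> Y"
  shows "\<exists>x\<in>W. \<forall>Y\<in>\<Y>. x \<notin> Y"
  using assms(1,3,4)
proof (induction \<Y> rule: finite_induct)
  case empty
  then show ?case using vec.subspace_0[OF W] by auto
next
  case (insert Z \<Y>)
  then obtain x where x: "x \<in> W" "\<forall>Y\<in>\<Y>. x \<notin> Y" by (metis insertI2)
  obtain y where y: "y \<in> W" "y \<notin> Z" using insert.prems(2)[of Z] by auto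
  have "\<exists>a. {c. x + c *s y \<in> Y} \<subseteq> {a}" if Y: "Y \<in> insert Z \<Y>" for Y
  proof -
    have "a = b" if ab: "x + a *s y \<in> Y" "x + b *s y \<in> Y" for a b
    proof (rule ccontr)
      assume "a \<noteq> b"
      have sY: "vec.subspace Y" using insert.prems(1)[OF Y] .
      have "(x + a *s y) - (x + b *s y) = (a - b) *s y" by (simp add: vec.scale_left_diff_distrib)
      then have "(a - b) *s y \<in> Y" using vec.subspace_diff[OF sY ab] by simp
      then have "(1 / (a - b)) *s ((a - b) *s y) \<in> Y" by (rule vec.subspace_scale[OF sY])
      then have yY: "y \<in> Y" using \<open>a \<noteq> b\<close> by (simp only: vector_smult_assoc) simp
      then have "(x + a *s y) - a *s y \<in> Y"
        by (intro vec.subspace_diff[OF sY ab(1)] vec.subspace_scale[OF sY])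
      then have "x \<in> Y" by simp
      then show False using yY y(2) x(2) Y by blast
    qed
    then show ?thesis by blast
  qed
  then have "finite (\<Union>Y\<in>insert Z \<Y>. {c. x + c *s y \<in> Y})"
    using insert.hyps(1) by (intro finite_UN_I) (auto intro: finite_subset)
  then obtain c where "c \<notin> (\<Union>Y\<in>insert Z \<Y>. {c. x + c *s y \<in> Y})"
    using ex_new_if_finite[OF infinite_UNIV_char_0[where 'a=complex]] by blast
  moreover have "x + c *s y \<in> W"
    by (intro vec.subspace_add[OF W] vec.subspace_scale[OF W] x(1) y(1))
  ultimately show ?case by blast
qed

text \<open>
  A version of Rado's theorem for subspaces, with a surplus \<open>k\<close> in Hall's condition.  The surplus
  ensures that each \<open>W i\<close> keeps dimension at least \<open>k\<close> modulo all the chosen vectors; the subspaces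
  in \<open>P\<close> have this property at the start and must keep it.

  The vectors are chosen one by one and divided out, which means adding them to \<open>R\<close>.  A generic
  \<open>x0\<close> in \<open>W i\<close> lies in the sum of the subspaces of a subfamily \<open>J\<close> only if all of \<open>W i\<close> does.
  Then \<open>J\<close> has the same sum as \<open>insert i J\<close>, whose larger Hall bound pays for the lost dimension.
\<close>

lemma generic_transversal:
  fixes W :: "'i \<Rightarrow> (complex^'n) set" and k :: nat
  assumes "finite I" "finite P" "\<And>i. i \<in> I \<Longrightarrow> vec.subspace (W i)"
    and "\<And>J. J \<subseteq> I \<Longrightarrow> J \<noteq> {} \<Longrightarrow> card J + k + vec.dim R \<le> vec.dim (\<Union>(W ` J) \<union> R)"
    and "\<And>U. U \<in> P \<Longrightarrow> k + vec.dim R \<le> vec.dim (U \<union> R)"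
  shows "\<exists>x. (\<forall>i\<in>I. x i \<in> W i) \<and> vec.dim (x ` I \<union> R) = card I + vec.dim R \<and>
    (\<forall>U \<in> P \<union> W ` I. k + card I + vec.dim R \<le> vec.dim (U \<union> (x ` I \<union> R)))"
  using assms
proof (induction I arbitrary: P R rule: finite_induct)
  case empty
  then show ?case by auto
next
  case (insert i I)
  note sub = insert.prems(2) and hall = insert.prems(3) and old = insert.prems(4)
  have Wi: "1 + k + vec.dim R \<le> vec.dim (W i \<union> R)" using hall[of "{i}"] by simp
  define \<Y> where "\<Y> = insert (vec.span R)
    ((\<lambda>J. vec.span (\<Union>(W ` J) \<union> R)) ` Pow I \<union> (\<lambda>U. vec.span (U \<union> R)) ` P)"
  have "\<exists>x\<in>W i. \<forall>Y\<in>{Y \<in> \<Y>. \<not> W i \<subseteq> Y}. x \<notin> Y"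
    by (rule avoid_finitely_many_subspaces)
      (use insert.hyps(1) insert.prems(1) sub in \<open>auto simp: \<Y>_def\<close>)
  then obtain x0 where x0: "x0 \<in> W i" and "\<forall>Y\<in>{Y \<in> \<Y>. \<not> W i \<subseteq> Y}. x0 \<notin> Y" by blast
  then have generic: "W i \<subseteq> Y" if "Y \<in> \<Y>" "x0 \<in> Y" for Y using that by blast
  have "x0 \<notin> vec.span R"
  proof
    assume "x0 \<in> vec.span R"
    then have "W i \<union> R \<subseteq> vec.span R"
      using generic[of "vec.span R"] vec.span_superset by (auto simp: \<Y>_def)
    then have "vec.dim (W i \<union> R) \<le> vec.dim R" by (rule vec.dim_mono)
    then show False using Wi by simp
  qed
  then have dR: "vec.dim (insert x0 R) = 1 + vec.dim R" by (simp add: vec.dim_insert)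
  have hall': "card J + k + vec.dim (insert x0 R) \<le> vec.dim (\<Union>(W ` J) \<union> insert x0 R)"
    if J: "J \<subseteq> I" "J \<noteq> {}" for J
  proof (cases "x0 \<in> vec.span (\<Union>(W ` J) \<union> R)")
    case True
    have "i \<notin> J" "finite J" using J insert.hyps finite_subset by auto
    then have "card (insert i J) + k + vec.dim R \<le> vec.dim (\<Union>(W ` insert i J) \<union> R)"
      using hall[of "insert i J"] J by blast
    also have "W i \<subseteq> vec.span (\<Union>(W ` J) \<union> R)"
      by (rule generic[OF _ True]) (use J in \<open>auto simp: \<Y>_def\<close>)
    then have "\<Union>(W ` insert i J) \<union> R \<subseteq> vec.span (\<Union>(W ` J) \<union> R)"
      using vec.span_superset[of "\<Union>(W ` J) \<union> R"] by auto
    then have "vec.dim (\<Union>(W ` insert i J) \<union> R) \<le> vec.dim (\<Union>(W ` J) \<union> R)" by (rule vec.dim_mono)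
    also have "\<dots> \<le> vec.dim (\<Union>(W ` J) \<union> insert x0 R)" by (rule vec.dim_subset) auto
    finally show ?thesis using dR \<open>i \<notin> J\<close> \<open>finite J\<close> by simp
  next
    case False
    then have "vec.dim (\<Union>(W ` J) \<union> insert x0 R) = 1 + vec.dim (\<Union>(W ` J) \<union> R)"
      by (simp add: vec.dim_insert)
    then show ?thesis using hall[of J] J dR by auto
  qed
  \<comment> \<open>The subspace just used joins those whose dimension has to be preserved.\<close>
  have old': "k + vec.dim (insert x0 R) \<le> vec.dim (U \<union> insert x0 R)" if U: "U \<in> insert (W i) P" for U
  proof (cases "x0 \<in> vec.span (U \<union> R)")
    case True
    have "W i \<subseteq> vec.span (U \<union> R)"
    proof (cases "U = W i")
      case True
      then show ?thesis using vec.span_superset[of "U \<union> R"] by auto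
    next
      case False
      then show ?thesis using U by (intro generic[OF _ True]) (auto simp: \<Y>_def)
    qed
    then have "W i \<union> R \<subseteq> vec.span (U \<union> R)" using vec.span_superset[of "U \<union> R"] by auto
    then have "vec.dim (W i \<union> R) \<le> vec.dim (U \<union> R)" by (rule vec.dim_mono)
    also have "\<dots> \<le> vec.dim (U \<union> insert x0 R)" by (rule vec.dim_subset) auto
    finally show ?thesis using Wi dR by simp
  next
    case False
    have "x0 \<in> vec.span (W i \<union> R)" using x0 by (simp add: vec.span_base)
    then have "U \<in> P" using U False by auto
    moreover have "vec.dim (U \<union> insert x0 R) = 1 + vec.dim (U \<union> R)" using False by (simp add: vec.dim_insert)
    ultimately show ?thesis using old[of U] dR by simp
  qed
  have "\<exists>x. (\<forall>j\<in>I. x j \<in> W j) \<and>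
      vec.dim (x ` I \<union> insert x0 R) = card I + vec.dim (insert x0 R) \<and>
      (\<forall>U \<in> insert (W i) P \<union> W ` I.
        k + card I + vec.dim (insert x0 R) \<le> vec.dim (U \<union> (x ` I \<union> insert x0 R)))"
    by (rule insert.IH) (use insert.prems(1) sub hall' old' in auto)
  then obtain x where x: "\<forall>j\<in>I. x j \<in> W j"
    "vec.dim (x ` I \<union> insert x0 R) = card I + vec.dim (insert x0 R)"
    "\<forall>U \<in> insert (W i) P \<union> W ` I.
        k + card I + vec.dim (insert x0 R) \<le> vec.dim (U \<union> (x ` I \<union> insert x0 R))" by blast
  define x' where "x' = x(i := x0)"
  have "x' ` I = x ` I" unfolding x'_def using insert.hyps(2) by (intro image_cong) auto
  then have im: "x' ` insert i I \<union> R = x ` I \<union> insert x0 R" by (auto simp: x'_def)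
  have "\<forall>j\<in>insert i I. x' j \<in> W j" using x(1) x0 by (auto simp: x'_def)
  moreover have "vec.dim (x' ` insert i I \<union> R) = card (insert i I) + vec.dim R"
    unfolding im using x(2) dR insert.hyps by simp
  moreover have "\<forall>U \<in> P \<union> W ` insert i I. 
      k + card (insert i I) + vec.dim R \<le> vec.dim (U \<union> (x' ` insert i I \<union> R))"
    unfolding im using x(3) dR insert.hyps by auto
  ultimately show ?case by blast
qed

text \<open>
  A basis of the span of \<open>R\<close> is extended to a basis of the whole space; the map that kills the former
  and sends the \<open>k\<close> new vectors to the unit vectors has the span of \<open>R\<close> as its kernel.
\<close>

lemma matrix_with_left_kernel_in:
  assumes "vec.dim R + CARD('k) = CARD('n)"
  shows "\<exists>B :: complex^'k^'n. \<forall>c. c v* B = 0 \<longrightarrow> c \<in> vec.span R"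
proof -
  obtain S where S: "S \<subseteq> vec.span R" "vec.independent S" "vec.span R \<subseteq> vec.span S"
      "card S = vec.dim (vec.span R)"
    using vec.basis_exists[of "vec.span R"] by blast
  obtain T where T: "S \<subseteq> T" "T \<subseteq> UNIV" "vec.independent T" "UNIV \<subseteq> vec.span T"
    using vec.maximal_independent_subset_extend[OF subset_UNIV S(2)] by blast
  have finT: "finite T" using T(3) by (rule vec.finiteI_independent)
  have "card T = CARD('n)"
    using vec.basis_card_eq_dim[OF T(2,4,3)] by (simp only: vec_dim_card)
  then have "card (T - S) = CARD('k)"
    using card_Diff_subset[OF finite_subset[OF T(1) finT] T(1)] S(4) assms by simp
  then obtain h where h: "bij_betw h (T - S) (UNIV :: 'k set)"
    using finite_same_card_bij[of "T - S" "UNIV::'k set"] finT by auto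
  define w :: "complex^'n \<Rightarrow> complex^'k" where "w v = (if v \<in> S then 0 else axis (h v) 1)" for v
  obtain f :: "complex^'n \<Rightarrow> complex^'k" where f: "Vector_Spaces.linear (*s) (*s) f"
    and fw: "\<And>v. v \<in> T \<Longrightarrow> f v = w v"
    using vec.linear_independent_extend[OF T(3), of w] by blast
  interpret f: Vector_Spaces.linear "(*s)" "(*s)" f by (rule f)
  have "c \<in> vec.span R" if c: "f c = 0" for c
  proof -
    have "c \<in> vec.span T" using T(4) by blast
    then obtain u where u: "c = (\<Sum>v\<in>T. u v *s v)" using vec.span_finite[OF finT] by auto
    have "u v = 0" if v: "v \<in> T - S" for v
    proof -
      have "0 = f c $ h v" using c by simp
      also have "f c = (\<Sum>v\<in>T. u v *s w v)" by (simp add: u f.sum f.scale fw)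
      also have "\<dots> $ h v = (\<Sum>y\<in>T. if y = v then u v else 0)"
        unfolding sum_component
      proof (rule sum.cong[OF refl])
        fix y assume y: "y \<in> T"
        show "(u y *s w y) $ h v = (if y = v then u v else 0)"
        proof (cases "y \<in> S")
          case True
          then show ?thesis using v by (auto simp: w_def)
        next
          case False
          then have "h y = h v \<longleftrightarrow> y = v"
            using h v y by (auto simp: bij_betw_def inj_on_def)
          then show ?thesis using False by (auto simp: w_def axis_def)
        qed
      qed
      also have "\<dots> = u v" using v finT by simp
      finally show ?thesis by simp
    qed
    then have "c = (\<Sum>v\<in>S. u v *s v)"
      unfolding u using T(1) finT by (intro sum.mono_neutral_right) auto
    also have "\<dots> \<in> vec.span R"
      using S(1) by (intro vec.span_sum vec.span_scale) auto
    finally show ?thesis .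
  qed
  moreover have "c v* transpose (matrix f) = f c" for c
    by (simp add: matrix_works[OF f])
  ultimately show ?thesis by (metis)
qed

section \<open>Relations between normal vectors and the discriminantal arrangement\<close>

definition coord :: "'n set \<Rightarrow> (complex^'n) set" where
  "coord X = {c. \<forall>p. p \<notin> X \<longrightarrow> c $ p = 0}"

definition relations :: "complex^'k^'n \<Rightarrow> 'n set \<Rightarrow> (complex^'n) set" where
  "relations A X = {c \<in> coord X. c v* A = 0}"

lemma subspace_coord [simp]: "vec.subspace (coord X)"
  by (auto simp: coord_def vec.subspace_def)

lemma coord_mono: "X \<subseteq> Y \<Longrightarrow> coord X \<subseteq> coord Y"
  by (auto simp: coord_def)

lemma dim_coord [simp]: "vec.dim (coord X) = card X"
  unfolding coord_def by (rule dim_substandard_cart)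

lemma subspace_relations: "vec.subspace (relations A X)"
  using subspace_coord[of X]
  by (auto simp: relations_def vec.subspace_def vector_matrix_left_distrib scalar_vector_matrix_assoc)

lemma relations_mono: "X \<subseteq> Y \<Longrightarrow> relations A X \<subseteq> relations A Y"
  using coord_mono by (auto simp: relations_def)

lemma row_mult: "(A *v x) $ p = pairing (A $ p) x"
  by (simp add: matrix_vector_mult_def pairing_def)

lemma pairing_mult: "pairing c (A *v x) = pairing (c v* A) x"
proof -
  have "pairing c (A *v x) = (\<Sum>p\<in>UNIV. \<Sum>j\<in>UNIV. c $ p * A $ p $ j * x $ j)"
    by (simp add: pairing_def matrix_vector_mult_def sum_distrib_left mult.assoc)
  also have "\<dots> = (\<Sum>j\<in>UNIV. \<Sum>p\<in>UNIV. c $ p * A $ p $ j * x $ j)" by (rule sum.swap)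
  also have "\<dots> = pairing (c v* A) x"
    by (simp add: pairing_def vector_matrix_mult_def sum_distrib_right)
  finally show ?thesis .
qed

lemma pairing_cong_coord:
  assumes "c \<in> coord X" "\<And>p. p \<in> X \<Longrightarrow> t $ p = u $ p"
  shows "pairing c t = pairing c u"
  unfolding pairing_def using assms by (intro sum.cong) (auto simp: coord_def)

lemma indep_rows_iff: "indep_family (($) A) X \<longleftrightarrow> relations A X \<subseteq> {0}"
proof
  have comb: "c v* A = (\<Sum>p\<in>X. c $ p *s A $ p)" if "c \<in> coord X" for c
  proof -
    have "c v* A = (\<Sum>p\<in>UNIV. c $ p *s A $ p)"
      by (simp add: vec_eq_iff vector_matrix_mult_def sum_component)
    also have "\<dots> = (\<Sum>p\<in>X. c $ p *s A $ p)"
      using that by (intro sum.mono_neutral_right) (auto simp: coord_def)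
    finally show ?thesis .
  qed
  {
    assume ind: "indep_family (($) A) X"
    show "relations A X \<subseteq> {0}"
    proof
      fix c assume c: "c \<in> relations A X"
      then have cX: "c \<in> coord X" by (simp add: relations_def)
      have "(\<Sum>p\<in>X. c $ p *s A $ p) = 0" using comb[OF cX] c by (simp add: relations_def)
      then have "\<forall>p\<in>X. c $ p = 0" using ind unfolding indep_family_def by blast
      then show "c \<in> {0}" using cX by (auto simp: vec_eq_iff coord_def)
    qed
  next
    assume rel: "relations A X \<subseteq> {0}"
    show "indep_family (($) A) X" unfolding indep_family_def
    proof (intro conjI allI impI ballI)
      fix u p assume u: "(\<Sum>p\<in>X. u p *s A $ p) = 0" and p: "p \<in> X"
      define c where "c = (\<chi> p. if p \<in> X then u p else 0)"
      have "c \<in> coord X" by (simp add: coord_def c_def)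
      moreover have "c v* A = 0" using comb[OF \<open>c \<in> coord X\<close>] u by (simp add: c_def)
      ultimately have "c = 0" using rel by (auto simp: relations_def)
      then have "c $ p = 0" by simp
      then show "u p = 0" using p by (simp add: c_def)
    qed simp
  }
qed

lemma Inter_hyp_central: "(\<Inter>p\<in>X. hyp A 0 p) = common_kernel (($) A) X"
  by (auto simp: hyp_def common_kernel_def row_mult)

lemma dim_kernel_step:
  assumes "vec.subspace S"
  shows "vec.dim S \<le> vec.dim {x \<in> S. pairing a x = 0} + 1"
proof (cases "\<exists>x0\<in>S. pairing a x0 \<noteq> 0")
  case True
  then obtain x0 where x0: "x0 \<in> S" "pairing a x0 \<noteq> 0" by blast
  let ?Z = "{x \<in> S. pairing a x = 0}"
  have "S \<subseteq> vec.span (insert x0 ?Z)"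
  proof
    fix x assume x: "x \<in> S"
    let ?r = "pairing a x / pairing a x0"
    have "pairing a (x + (- ?r) *s x0) = 0" using x0(2) by (simp only: pairing_simps) simp
    moreover have "x + (- ?r) *s x0 \<in> S"
      by (intro vec.subspace_add[OF assms] vec.subspace_scale[OF assms] x x0(1))
    ultimately have "x + (- ?r) *s x0 \<in> vec.span (insert x0 ?Z)" by (intro vec.span_base) simp
    moreover have "?r *s x0 \<in> vec.span (insert x0 ?Z)" by (intro vec.span_scale vec.span_base) simp
    ultimately have "(x + (- ?r) *s x0) + ?r *s x0 \<in> vec.span (insert x0 ?Z)" by (rule vec.span_add)
    then show "x \<in> vec.span (insert x0 ?Z)" by (simp add: add.assoc flip: vec.scale_left_distrib)
  qed
  then have "vec.dim S \<le> vec.dim (insert x0 ?Z)" by (rule vec.dim_mono)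
  also have "\<dots> \<le> vec.dim ?Z + 1" by (simp add: vec.dim_insert)
  finally show ?thesis .
next
  case False
  then have "{x \<in> S. pairing a x = 0} = S" by auto
  then show ?thesis by simp
qed

lemma subspace_common_kernel: "vec.subspace (common_kernel a F)"
  by (auto simp: vec.subspace_def common_kernel_def)

lemma dim_common_kernel_insert:
  "vec.dim (common_kernel a F) \<le> vec.dim (common_kernel a (insert e F)) + 1"
proof -
  have "common_kernel a (insert e F) = {x \<in> common_kernel a F. pairing (a e) x = 0}"
    by (auto simp: common_kernel_def)
  then show ?thesis using dim_kernel_step[OF subspace_common_kernel, of a F "a e"] by (simp only:)
qed

lemma dim_common_kernel_Un:
  assumes "finite G"
  shows "vec.dim (common_kernel a F) \<le> vec.dim (common_kernel a (F \<union> G)) + card G"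
  using assms
proof (induction G rule: finite_induct)
  case (insert e G)
  then show ?case using dim_common_kernel_insert[of a "F \<union> G" e] by simp
qed simp

lemma dim_common_kernel_indep:
  fixes a :: "'i \<Rightarrow> complex^'k"
  assumes "indep_family a K" "card K = CARD('k)"
  shows "common_kernel a K = {0}"
proof -
  have ind: "inj_on a K" "vec.independent (a ` K)" using assms indep_family_iff_independent by blast+
  have "card (a ` K) = vec.dim (UNIV :: (complex^'k) set)"
    using card_image[OF ind(1)] assms(2) by (simp only: vec_dim_card)
  then have "UNIV \<subseteq> vec.span (a ` K)"
    using vec.card_ge_dim_independent[OF subset_UNIV ind(2)] by simp
  have "x = 0" if x: "x \<in> common_kernel a K" for x
  proof -
    have "pairing v x = 0" if "v \<in> vec.span (a ` K)" for v
      using that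
    proof (induction rule: vec.span_induct_alt)
      case (step c y z)
      then show ?case using x by (auto simp: common_kernel_def)
    qed simp
    then have "pairing (axis j 1) x = 0" for j using \<open>UNIV \<subseteq> _\<close> by blast
    moreover have "pairing (axis j 1) x = x $ j" for j
      by (simp add: pairing_def axis_def if_distrib[of "\<lambda>u. u * _"] cong: if_cong)
    ultimately show ?thesis by (simp add: vec_eq_iff)
  qed
  then show ?thesis by (auto simp: common_kernel_def)
qed

text \<open>
  The case \<open>card I = k\<close> of the definition says that any \<open>k\<close> normal vectors are a basis.  The other
  dimensions follow, because each equation lowers the dimension by at most one and \<open>k\<close> suitable
  equations lower it from \<open>k\<close> to \<open>0\<close>.
\<close>

lemma central_generic_iff:
  fixes A :: "complex^'k^'n"
  assumes kn: "CARD('k) \<le> CARD('n)"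
  shows "central_generic A \<longleftrightarrow> (\<forall>K. card K = CARD('k) \<longrightarrow> relations A K \<subseteq> {0})"
proof
  assume cg: "central_generic A"
  then have dim: "vec.dim (common_kernel (($) A) I) = CARD('k) - card I" if "card I \<le> CARD('k)" for I
    using that by (simp add: central_generic_def Inter_hyp_central)
  show "\<forall>K. card K = CARD('k) \<longrightarrow> relations A K \<subseteq> {0}"
  proof (intro allI impI)
    fix K :: "'n set" assume K: "card K = CARD('k)"
    obtain I where I: "I \<subseteq> K" "indep_family (($) A) I" "common_kernel (($) A) I = common_kernel (($) A) K"
      using common_kernel_basis_exists[of K "($) A"] by auto
    have le: "card I \<le> CARD('k)" using card_mono[OF finite I(1)] K by simp
    then have "CARD('k) - card I = 0" using dim[of I] dim[of K] I(3) K by simp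
    then have "card I = card K" using le K by simp
    then have "I = K" using card_subset_eq[OF finite I(1)] by simp
    then show "relations A K \<subseteq> {0}" using I(2) by (simp add: indep_rows_iff)
  qed
next
  assume rel: "\<forall>K. card K = CARD('k) \<longrightarrow> relations A K \<subseteq> {0}"
  show "central_generic A" unfolding central_generic_def Inter_hyp_central
  proof (intro allI impI)
    fix I :: "'n set" assume I: "card I \<le> CARD('k)"
    obtain K where K: "I \<subseteq> K" "card K = CARD('k)"
      using exists_subset_between[OF I kn subset_UNIV finite] by (elim exE conjE) (rule that)
    have "common_kernel (($) A) K = {0}"
      using rel K(2) by (intro dim_common_kernel_indep) (simp_all add: indep_rows_iff)
    moreover have "I \<union> (K - I) = K" using K(1) by blast
    ultimately have "vec.dim (common_kernel (($) A) I) \<le> card (K - I)"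
      using dim_common_kernel_Un[of "K - I" "($) A" I] by simp
    moreover have "card (K - I) = CARD('k) - card I" using K by (simp add: card_Diff_subset)
    moreover have "CARD('k) \<le> vec.dim (common_kernel (($) A) I) + card I"
    proof -
      have "common_kernel (($) A) {} = UNIV" by (simp add: common_kernel_def)
      then show ?thesis
        using dim_common_kernel_Un[of I "($) A" "{}"] by (simp only: vec_dim_card finite Un_empty_left)
    qed
    ultimately show "vec.dim (common_kernel (($) A) I) = CARD('k) - card I" by linarith
  qed
qed

context
  fixes A :: "complex^'k^'n"
  assumes kn: "CARD('k) < CARD('n)" and cg: "central_generic A"
begin

lemma no_small_relations:
  assumes "card K = CARD('k)" "c \<in> relations A K" shows "c = 0"
  using assms cg central_generic_iff[of A] kn by auto

lemma common_point_unique: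
  assumes "CARD('k) \<le> card K" "\<And>p. p \<in> K \<Longrightarrow> (A *v x) $ p = (A *v y) $ p"
  shows "x = y"
proof -
  obtain K' where K': "K' \<subseteq> K" "card K' = CARD('k)" by (rule obtain_subset_with_card_n[OF assms(1)])
  then have "common_kernel (($) A) K' = {0}"
    using no_small_relations by (intro dim_common_kernel_indep) (auto simp: indep_rows_iff)
  moreover have "x - y \<in> common_kernel (($) A) K'"
    using assms(2) K'(1)
    by (auto simp: common_kernel_def row_mult[symmetric] matrix_vector_mult_diff_distrib)
  ultimately show ?thesis by simp
qed

lemma common_point_exists:
  assumes "card K = CARD('k)"
  shows "\<exists>x. \<forall>p\<in>K. (A *v x) $ p = t $ p"
proof -
  have ind: "indep_family (($) A) K"
    unfolding indep_rows_iff using no_small_relations[OF assms] by blast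
  have "\<forall>p\<in>K. \<exists>y. y \<in> common_kernel (($) A) (K - {p}) \<and> pairing (A $ p) y = 1"
    using dual_vector_exists[OF ind] by blast
  from bchoice[OF this] obtain y where
    y: "\<forall>p\<in>K. y p \<in> common_kernel (($) A) (K - {p}) \<and> pairing (A $ p) (y p) = 1"
    by (rule exE)
  \<comment> \<open>Interpolation with the basis dual to the rows in \<open>K\<close>.\<close>
  define x where "x = (\<Sum>p\<in>K. t $ p *s y p)"
  have "(A *v x) $ q = t $ q" if q: "q \<in> K" for q
  proof -
    have "(A *v x) $ q = (\<Sum>p\<in>K. t $ p * pairing (A $ q) (y p))"
      by (simp add: x_def vec.sum vec.scale sum_component row_mult)
    also have "\<dots> = (\<Sum>p\<in>K. if p = q then t $ q else 0)"
    proof (rule sum.cong[OF refl])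
      fix p assume p: "p \<in> K"
      show "t $ p * pairing (A $ q) (y p) = (if p = q then t $ q else 0)"
        using bspec[OF y p] q by (auto simp: common_kernel_def)
    qed
    also have "\<dots> = t $ q" using q by simp
    finally show ?thesis .
  qed
  then show ?thesis by blast
qed

text \<open>
  There are \<open>k + 1\<close> normal vectors in a space of dimension \<open>k\<close>, hence a relation; it involves all of
  them, as any \<open>k\<close> of them are independent.
\<close>

lemma circuit_exists:
  assumes "card L = CARD('k) + 1"
  shows "\<exists>c. c \<in> relations A L \<and> (\<forall>p\<in>L. c $ p \<noteq> 0)"
proof -
  have "\<not> indep_family (($) A) L"
  proof
    assume "indep_family (($) A) L"
    then have "card L \<le> vec.dim (UNIV :: (complex^'k) set)"
      using vec.independent_card_le_dim[OF subset_UNIV, of "($) A ` L"]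
      by (auto simp: indep_family_iff_independent card_image)
    then show False using assms by (simp only: vec_dim_card)
  qed
  then obtain c where c: "c \<in> relations A L" "c \<noteq> 0" by (auto simp: indep_rows_iff)
  have "c $ p \<noteq> 0" if p: "p \<in> L" for p
  proof
    assume "c $ p = 0"
    then have "c \<in> relations A (L - {p})" using c(1) by (auto simp: relations_def coord_def)
    then show False using no_small_relations[of "L - {p}"] c(2) assms p by simp
  qed
  then show ?thesis using c by blast
qed

end

text \<open>
  Determined up to a scalar when \<open>L\<close> has \<open>k + 1\<close> elements.  By Cramer's rule its entries are the signed
  maximal minors of the rows in \<open>L\<close>.
\<close>

definition circuit :: "complex^'k^'n \<Rightarrow> 'n set \<Rightarrow> complex^'n" where
  "circuit A L = (SOME c. c \<in> relations A L \<and> (\<forall>p\<in>L. c $ p \<noteq> 0))"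

text \<open>
  The sum of the spaces \<open>relations A L\<close> is direct.  For central generic arrangements this is the
  independence of the circuits, but it is meaningful for degenerate matrices, where \<open>relations A L\<close>
  can have larger dimension and no circuit is distinguished.  It also says that a linear map with
  entries affine in \<open>A\<close> is injective, so that it can be followed along a line of matrices.
\<close>

definition relations_independent :: "complex^'k^'n \<Rightarrow> 'n set set \<Rightarrow> bool" where
  "relations_independent A F \<longleftrightarrow>
    (\<forall>c. (\<forall>L\<in>F. c L \<in> relations A L) \<and> (\<Sum>L\<in>F. c L) = 0 \<longrightarrow> (\<forall>L\<in>F. c L = 0))"

context
  fixes A :: "complex^'k^'n"
  assumes kn: "CARD('k) < CARD('n)" and cg: "central_generic A"
begin

lemma circuit:
  assumes "card L = CARD('k) + 1"
  shows circuit_relation: "circuit A L \<in> relations A L"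
    and circuit_nonzero: "p \<in> L \<Longrightarrow> circuit A L $ p \<noteq> 0"
  using someI_ex[OF circuit_exists[OF kn cg assms]] unfolding circuit_def by blast+

lemma relation_multiple_of_circuit:
  assumes L: "card L = CARD('k) + 1" and c: "c \<in> relations A L"
  shows "\<exists>s. c = s *s circuit A L"
proof -
  have "L \<noteq> {}" using L by auto
  then obtain p where p: "p \<in> L" by blast
  let ?s = "c $ p / circuit A L $ p"
  have "c - ?s *s circuit A L \<in> relations A L"
    by (intro vec.subspace_diff vec.subspace_scale subspace_relations circuit_relation[OF L] c)
  moreover have "(c - ?s *s circuit A L) $ p = 0" using circuit_nonzero[OF L p] by simp
  ultimately have "c - ?s *s circuit A L \<in> relations A (L - {p})"
    by (auto simp: relations_def coord_def)
  moreover have "card (L - {p}) = CARD('k)" using L p by simp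
  ultimately have "c - ?s *s circuit A L = 0" by (intro no_small_relations[OF kn cg])
  then show ?thesis by (intro exI[of _ ?s]) (rule eq_iff_diff_eq_0[THEN iffD2])
qed

lemma mem_D_hyp_iff_pairing:
  assumes L: "card L = CARD('k) + 1"
  shows "t \<in> D_hyp A L \<longleftrightarrow> pairing (circuit A L) t = 0"
proof -
  have rel: "circuit A L \<in> coord L" "circuit A L v* A = 0"
    using circuit_relation[OF L] by (auto simp: relations_def)
  have "L \<noteq> {}" using L by auto
  then obtain p where p: "p \<in> L" by blast
  have zero: "pairing (circuit A L) (A *v x) = 0" for x by (simp add: pairing_mult rel)
  show ?thesis
  proof
    assume "t \<in> D_hyp A L"
    then obtain x where "\<And>p. p \<in> L \<Longrightarrow> (A *v x) $ p = t $ p" by (auto simp: D_hyp_def hyp_def)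
    then show "pairing (circuit A L) t = 0"
      using pairing_cong_coord[OF rel(1), of "A *v x" t] zero[of x] by simp
  next
    assume t: "pairing (circuit A L) t = 0"
    obtain x where x: "\<forall>q\<in>L - {p}. (A *v x) $ q = t $ q"
      using common_point_exists[OF kn cg, of "L - {p}" t] L p by auto
    \<comment> \<open>The defect of \<open>x\<close> is concentrated in \<open>p\<close>, where the circuit does not vanish.\<close>
    define d where "d = t + (-1) *s (A *v x)"
    have "pairing (circuit A L) d = 0" unfolding d_def pairing_simps t zero by simp
    moreover have "pairing (circuit A L) d = pairing (circuit A L) (axis p (d $ p))"
      using x by (intro pairing_cong_coord[OF rel(1)]) (auto simp: d_def axis_def)
    ultimately have "d $ p = 0" using circuit_nonzero[OF L p] by simp
    then have "\<forall>q\<in>L. (A *v x) $ q = t $ q" using x by (auto simp: d_def)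
    then show "t \<in> D_hyp A L" by (auto simp: D_hyp_def hyp_def)
  qed
qed

lemma intersection_lattice_eq:
  "intersection_lattice A = common_kernel (circuit A) ` Pow {L. card L = CARD('k) + 1}"
proof -
  have D: "discriminantal A = D_hyp A ` {L. card L = CARD('k) + 1}"
    by (auto simp: discriminantal_def)
  have "\<Inter>(D_hyp A ` G) = common_kernel (circuit A) G" if "G \<subseteq> {L. card L = CARD('k) + 1}" for G
    using that mem_D_hyp_iff_pairing by (fastforce simp: common_kernel_def)
  then show ?thesis
    by (auto simp: intersection_lattice_def D subset_image_iff image_iff Bex_def)
qed

lemma relations_independent_iff:
  assumes F: "\<And>L. L \<in> F \<Longrightarrow> card L = CARD('k) + 1"
  shows "relations_independent A F \<longleftrightarrow> indep_family (circuit A) F"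
proof
  assume rel: "relations_independent A F"
  show "indep_family (circuit A) F" unfolding indep_family_def
  proof (intro conjI allI impI ballI)
    fix s L assume s: "(\<Sum>L\<in>F. s L *s circuit A L) = 0" and L: "L \<in> F"
    have "s M *s circuit A M \<in> relations A M" if "M \<in> F" for M
      by (intro vec.subspace_scale subspace_relations circuit_relation F that)
    then have "s L *s circuit A L = 0"
      using rel s L unfolding relations_independent_def by (elim allE[of _ "\<lambda>L. s L *s circuit A L"]) blast
    moreover have "L \<noteq> {}" using F[OF L] by auto
    then have "circuit A L \<noteq> 0" using circuit_nonzero[OF F[OF L]] by force
    ultimately show "s L = 0" by simp
  qed simp
next
  assume ind: "indep_family (circuit A) F"
  show "relations_independent A F" unfolding relations_independent_def
  proof (intro allI impI, elim conjE)
    fix c :: "'n set \<Rightarrow> complex^'n"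
    assume c: "\<forall>L\<in>F. c L \<in> relations A L" "(\<Sum>L\<in>F. c L) = 0"
    have "\<forall>L\<in>F. \<exists>s. c L = s *s circuit A L" using relation_multiple_of_circuit c(1) F by blast
    from bchoice[OF this] obtain s where s: "\<forall>L\<in>F. c L = s L *s circuit A L" by (rule exE)
    then have "(\<Sum>L\<in>F. s L *s circuit A L) = 0" using c(2) by simp
    then have "\<forall>L\<in>F. s L = 0" using ind unfolding indep_family_def by blast
    then show "\<forall>L\<in>F. c L = 0" using s by simp
  qed
qed

end

section \<open>A matrix with independent relations\<close>

lemma card_Union_le_dim_coord: "card (\<Union>J) \<le> vec.dim (\<Union>(coord ` J))"
proof -
  have "coord (\<Union>J) \<subseteq> vec.span (\<Union>(coord ` J))"
  proof
    fix c assume c: "c \<in> coord (\<Union>J)"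
    have "c = (\<Sum>p\<in>\<Union>J. c $ p *s axis p 1)"
      using c by (auto simp: vec_eq_iff axis_def coord_def if_distrib sum_component cong: if_cong)
    also have "\<dots> \<in> vec.span (\<Union>(coord ` J))"
      by (intro vec.span_sum vec.span_scale vec.span_base) (auto simp: coord_def axis_def)
    finally show "c \<in> vec.span (\<Union>(coord ` J))" .
  qed
  then have "vec.dim (coord (\<Union>J)) \<le> vec.dim (\<Union>(coord ` J))" by (rule vec.dim_mono)
  then show ?thesis by simp
qed

text \<open>
  Vectors \<open>x L\<close> with support in \<open>L\<close> are chosen independent, and further vectors \<open>y i\<close> are added to
  fill up a space \<open>R\<close> of dimension \<open>n - k\<close>, the left kernel of the desired matrix.  The vectors
  supported in \<open>L\<close> have dimension \<open>k + 1\<close> and keep at least \<open>k\<close> modulo \<open>R\<close>, so that the relations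
  inside \<open>L\<close> are exactly the multiples of \<open>x L\<close>.
\<close>

lemma independent_relations_exist:
  fixes F :: "'n::finite set set"
  assumes card: "\<And>L. L \<in> F \<Longrightarrow> card L = CARD('k) + 1"
    and surplus: "\<And>G. G \<subseteq> F \<Longrightarrow> G \<noteq> {} \<Longrightarrow> card G + CARD('k) \<le> card (\<Union>G)"
  shows "\<exists>B :: complex^'k^'n. relations_independent B F"
proof (cases "F = {}")
  case True
  then show ?thesis by (simp add: relations_independent_def)
next
  case False
  have nF: "card F + CARD('k) \<le> CARD('n)"
    using surplus[OF subset_refl False] card_mono[OF finite, of "\<Union>F" UNIV] by simp
  define E :: "(complex^'n) set" where "E = {}"
  have "\<exists>x. (\<forall>L\<in>F. x L \<in> coord L) \<and> vec.dim (x ` F \<union> E) = card F + vec.dim E \<and>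
      (\<forall>U \<in> {} \<union> coord ` F. CARD('k) + card F + vec.dim E \<le> vec.dim (U \<union> (x ` F \<union> E)))"
  proof (rule generic_transversal)
    fix J assume "J \<subseteq> F" "J \<noteq> {}"
    then show "card J + CARD('k) + vec.dim E \<le> vec.dim (\<Union>(coord ` J) \<union> E)"
      using surplus[of J] card_Union_le_dim_coord[of J] by (simp add: E_def)
  qed auto
  then obtain x where x: "\<And>L. L \<in> F \<Longrightarrow> x L \<in> coord L" "vec.dim (x ` F) = card F"
    "\<And>L. L \<in> F \<Longrightarrow> CARD('k) + card F \<le> vec.dim (coord L \<union> x ` F)"
    by (auto simp: E_def)
  define m where "m = CARD('n) - CARD('k) - card F"
  have "\<exists>y. (\<forall>i\<in>{..<m}. y i \<in> UNIV) \<and>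
      vec.dim (y ` {..<m} \<union> x ` F) = card {..<m} + vec.dim (x ` F) \<and>
      (\<forall>U \<in> coord ` F \<union> (\<lambda>_. UNIV) ` {..<m}.
        CARD('k) + card {..<m} + vec.dim (x ` F) \<le> vec.dim (U \<union> (y ` {..<m} \<union> x ` F)))"
  proof (rule generic_transversal)
    fix J assume J: "J \<subseteq> {..<m}" "J \<noteq> {}"
    have "card J \<le> m" using card_mono[OF finite_lessThan J(1)] by simp
    moreover have "\<Union>((\<lambda>_. UNIV) ` J) \<union> x ` F = UNIV" using J(2) by auto
    ultimately show "card J + CARD('k) + vec.dim (x ` F) \<le> vec.dim (\<Union>((\<lambda>_. UNIV) ` J) \<union> x ` F)"
      using nF x(2) by (simp only: vec_dim_card m_def)
  qed (use x(2,3) in auto)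
  then obtain y where y: "vec.dim (y ` {..<m} \<union> x ` F) = m + card F"
    "\<And>L. L \<in> F \<Longrightarrow> CARD('k) + m + card F \<le> vec.dim (coord L \<union> (y ` {..<m} \<union> x ` F))"
    using x(2) by auto
  define R where "R = y ` {..<m} \<union> x ` F"
  have dR: "vec.dim R + CARD('k) = CARD('n)" using y(1) nF by (simp add: R_def m_def)
  then obtain B :: "complex^'k^'n" where B: "\<And>c. c v* B = 0 \<Longrightarrow> c \<in> vec.span R"
    using matrix_with_left_kernel_in by blast
  have ind: "indep_family x F" using x(2) by (intro indep_family_if_dim) auto
  have line: "\<exists>s. c = s *s x L" if L: "L \<in> F" and c: "c \<in> relations B L" for L c
  proof -
    let ?Q = "coord L \<inter> vec.span R"
    \<comment> \<open>The two subspaces together span everything, which bounds their intersection.\<close>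
    have "CARD('n) \<le> vec.dim (coord L \<union> R)" using y(2)[OF L] dR y(1) by (simp add: R_def)
    also have "\<dots> \<le> vec.dim {a + b |a b. a \<in> coord L \<and> b \<in> vec.span R}"
    proof (rule vec.dim_subset, rule subsetI)
      fix v assume "v \<in> coord L \<union> R"
      then show "v \<in> {a + b |a b. a \<in> coord L \<and> b \<in> vec.span R}"
      proof
        assume "v \<in> coord L"
        then show ?thesis using vec.span_zero by (intro CollectI exI[of _ v] exI[of _ 0]) simp
      next
        assume "v \<in> R"
        then have "v = 0 + v \<and> 0 \<in> coord L \<and> v \<in> vec.span R"
          by (simp add: vec.subspace_0[OF subspace_coord] vec.span_base)
        then show ?thesis by blast
      qed
    qed
    finally have "vec.dim ?Q \<le> 1"
      using vec.dim_sums_Int[OF subspace_coord vec.subspace_span, of L R] card[OF L] dR by simp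
    moreover have "{x L} \<subseteq> ?Q" using x(1)[OF L] L by (auto simp: R_def vec.span_base)
    moreover have "vec.independent {x L}"
      using indep_family_nonzero[OF ind L] by (simp add: vec.dependent_single)
    ultimately have "?Q \<subseteq> vec.span {x L}" by (intro vec.card_ge_dim_independent) auto
    moreover have "c \<in> ?Q" using c B by (auto simp: relations_def)
    ultimately show ?thesis by (auto simp: vec.span_singleton)
  qed
  have "relations_independent B F" unfolding relations_independent_def
  proof (intro allI impI, elim conjE)
    fix c :: "'n set \<Rightarrow> complex^'n"
    assume c: "\<forall>L\<in>F. c L \<in> relations B L" "(\<Sum>L\<in>F. c L) = 0"
    have "\<forall>L\<in>F. \<exists>s. c L = s *s x L" using line c(1) by simp
    from bchoice[OF this] obtain s where s: "\<forall>L\<in>F. c L = s L *s x L" by (rule exE)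
    then have "(\<Sum>L\<in>F. s L *s x L) = 0" using c(2) by simp
    then have "\<forall>L\<in>F. s L = 0" using ind unfolding indep_family_def by blast
    then show "\<forall>L\<in>F. c L = 0" using s by simp
  qed
  then show ?thesis by blast
qed

section \<open>Perturbing an arrangement\<close>

definition pencil :: "complex^'k^'n \<Rightarrow> complex^'k^'n \<Rightarrow> complex \<Rightarrow> complex^'k^'n" where
  "pencil A C z = (\<chi> p j. A $ p $ j + z * C $ p $ j)"

lemma vector_mult_pencil: "c v* pencil A C z = c v* A + z *s (c v* C)"
  by (simp add: pencil_def vec_eq_iff vector_matrix_mult_def algebra_simps sum.distrib sum_distrib_left)

lemma finite_dependent_rows_pencil:
  assumes "relations A X \<subseteq> {0}"
  shows "finite {z. \<not> relations (pencil A C z) X \<subseteq> {0}}"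
proof -
  have "finite {z. \<exists>v\<in>coord X. v \<noteq> 0 \<and> transpose A *v v + z *s (transpose C *v v) = 0}"
    by (rule finite_degenerate_parameters) (use assms in \<open>auto simp: relations_def\<close>)
  moreover have "{z. \<not> relations (pencil A C z) X \<subseteq> {0}}
      \<subseteq> {z. \<exists>v\<in>coord X. v \<noteq> 0 \<and> transpose A *v v + z *s (transpose C *v v) = 0}"
    by (auto simp: relations_def vector_mult_pencil)
  ultimately show ?thesis by (rule rev_finite_subset)
qed

text \<open>
  The families \<open>c\<close> in the definition of independent relations form one vector space \<open>V\<close>, encoded with
  coordinates indexed by pairs \<open>(L, p)\<close>.  The matrix \<open>M B s\<close> sends such a family to all the vectors
  \<open>c L v* B\<close>, in the rows \<open>Inl (L, j)\<close>, and to \<open>s\<close> times their sum, in the rows \<open>Inr p\<close>.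
  Independence of the relations of \<open>pencil A C z\<close> is thus injectivity on \<open>V\<close> of the pencil
  \<open>M A 1 + z M C 0\<close>: the equation for the sum does not depend on \<open>z\<close>.
\<close>

lemma finite_dependent_relations_pencil:
  fixes A C :: "complex^'k^'n"
  assumes "relations_independent A F"
  shows "finite {z. \<not> relations_independent (pencil A C z) F}"
proof -
  define slice :: "complex^('n set \<times> 'n) \<Rightarrow> 'n set \<Rightarrow> complex^'n"
    where "slice v L = (\<chi> p. v $ (L, p))" for v L
  define V where "V = {v. (\<forall>L\<in>F. slice v L \<in> coord L) \<and> (\<forall>L. L \<notin> F \<longrightarrow> slice v L = 0)}"
  define M :: "complex^'k^'n \<Rightarrow> complex \<Rightarrow> complex^('n set \<times> 'n)^(('n set \<times> 'k) + 'n)" where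
    "M B s = (\<chi> r i. case r of
        Inl (L, j) \<Rightarrow> if fst i = L then B $ snd i $ j else 0
      | Inr p \<Rightarrow> if snd i = p then s else 0)" for B s
  have M1: "(M B s *v v) $ Inl (L, j) = (slice v L v* B) $ j" for B s v L j
  proof -
    have "(M B s *v v) $ Inl (L, j) = (\<Sum>L'\<in>UNIV. \<Sum>p\<in>UNIV. if L' = L then B $ p $ j * v $ (L', p) else 0)"
      unfolding sum.cartesian_product UNIV_Times_UNIV matrix_vector_mult_def M_def
      by simp (rule sum.cong, auto split: if_splits)
    also have "\<dots> = (\<Sum>L'\<in>UNIV. if L' = L then \<Sum>p\<in>UNIV. B $ p $ j * v $ (L, p) else 0)"
      by (intro sum.cong) auto
    finally show ?thesis
      by (simp add: slice_def vector_matrix_mult_def mult.commute)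
  qed
  have M2: "(M B s *v v) $ Inr p = s * (\<Sum>L\<in>UNIV. slice v L) $ p" for B s v p
  proof -
    have "(M B s *v v) $ Inr p = (\<Sum>L\<in>UNIV. \<Sum>q\<in>UNIV. if q = p then s * v $ (L, q) else 0)"
      unfolding sum.cartesian_product UNIV_Times_UNIV matrix_vector_mult_def M_def
      by simp (rule sum.cong, auto split: if_splits)
    then show ?thesis by (simp add: slice_def sum_component sum_distrib_left)
  qed
  have sumV: "(\<Sum>L\<in>UNIV. slice v L) = (\<Sum>L\<in>F. slice v L)" if "v \<in> V" for v
    using that by (intro sum.mono_neutral_right) (auto simp: V_def)
  have zero: "v = 0" if "\<And>L. slice v L = 0" for v
    using that by (simp add: slice_def vec_eq_iff)
  have subV: "vec.subspace V"
    by (auto simp: V_def vec.subspace_def slice_def coord_def vec_eq_iff)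
  have inj: "v = 0" if v: "v \<in> V" "M A 1 *v v = 0" for v
  proof -
    have "slice v L v* A = 0" for L using M1[of A 1 v L] v(2) by (simp add: vec_eq_iff)
    moreover have "(\<Sum>L\<in>UNIV. slice v L) = 0" using M2[of A 1 v] v(2) by (simp add: vec_eq_iff)
    ultimately have "(\<forall>L\<in>F. slice v L \<in> relations A L) \<and> (\<Sum>L\<in>F. slice v L) = 0"
      using v(1) sumV[OF v(1)] by (simp add: relations_def V_def)
    then have "\<forall>L\<in>F. slice v L = 0"
      by (rule assms[unfolded relations_independent_def, THEN spec, THEN mp])
    then show ?thesis using v(1) by (intro zero) (auto simp: V_def)
  qed
  have "\<exists>v\<in>V. v \<noteq> 0 \<and> M A 1 *v v + z *s (M C 0 *v v) = 0"
    if bad: "\<not> relations_independent (pencil A C z) F" for z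
  proof -
    obtain c where c: "\<And>L. L \<in> F \<Longrightarrow> c L \<in> relations (pencil A C z) L" "(\<Sum>L\<in>F. c L) = 0"
      and "\<exists>L\<in>F. c L \<noteq> 0" using bad unfolding relations_independent_def by blast
    then obtain L0 where L0: "L0 \<in> F" "c L0 \<noteq> 0" by blast
    define v :: "complex^('n set \<times> 'n)" where "v = (\<chi> i. if fst i \<in> F then c (fst i) $ snd i else 0)"
    have slice: "slice v L = (if L \<in> F then c L else 0)" for L
      by (simp add: slice_def v_def vec_eq_iff)
    have "v \<in> V" using c(1) by (auto simp: V_def slice relations_def)
    moreover have "v \<noteq> 0"
    proof
      assume "v = 0"
      then have "slice v L0 = 0" by (simp add: slice_def vec_eq_iff)
      then show False using L0 by (simp add: slice)
    qed
    moreover have "(M A 1 *v v + z *s (M C 0 *v v)) $ r = 0" for r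
    proof (cases r)
      case (Inl i)
      obtain L j where i: "i = (L, j)" by (cases i)
      have "slice v L v* pencil A C z = 0"
        using c(1)[of L] by (auto simp: slice relations_def)
      then have "(slice v L v* A + z *s (slice v L v* C)) $ j = 0" by (simp add: vector_mult_pencil)
      then show ?thesis by (simp add: Inl i M1)
    next
      case (Inr p)
      have "(\<Sum>L\<in>F. slice v L) = 0" using c(2) by (simp add: slice)
      then show ?thesis using sumV[OF \<open>v \<in> V\<close>] by (simp add: Inr M2)
    qed
    ultimately show ?thesis by (intro bexI[of _ v]) (simp_all add: vec_eq_iff)
  qed
  then have "{z. \<not> relations_independent (pencil A C z) F}
      \<subseteq> {z. \<exists>v\<in>V. v \<noteq> 0 \<and> M A 1 *v v + z *s (M C 0 *v v) = 0}" by blast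
  moreover have "finite {z. \<exists>v\<in>V. v \<noteq> 0 \<and> M A 1 *v v + z *s (M C 0 *v v) = 0}"
    by (rule finite_degenerate_parameters[OF subV]) (rule inj)
  ultimately show ?thesis by (rule finite_subset)
qed

text \<open>
  Finitely many conditions hold at the point \<open>A\<close> of the line and one at the point \<open>B\<close>; each of them
  fails for only finitely many points of the line.
\<close>

lemma generic_perturbation:
  fixes A B :: "complex^'k^'n"
  assumes kn: "CARD('k) < CARD('n)" and cg: "central_generic A" and B: "relations_independent B F"
  shows "\<exists>A' :: complex^'k^'n. central_generic A' \<and> relations_independent A' F \<and>
    (\<forall>G. relations_independent A G \<longrightarrow> relations_independent A' G)"
proof -
  define C where "C = (\<chi> p j. B $ p $ j - A $ p $ j)"
  \<comment> \<open>The same line with \<open>B\<close> as its origin.\<close>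
  have reverse: "pencil A C z = pencil B (\<chi> p j. - C $ p $ j) (1 - z)" for z
    by (simp add: pencil_def C_def vec_eq_iff algebra_simps)
  define bad where "bad = (\<Union>K\<in>{K. relations A K \<subseteq> {0}}. {z. \<not> relations (pencil A C z) K \<subseteq> {0}}) \<union>
     (\<Union>G\<in>{G. relations_independent A G}. {z. \<not> relations_independent (pencil A C z) G}) \<union>
     {z. \<not> relations_independent (pencil A C z) F}"
  have "finite (\<Union>K\<in>{K. relations A K \<subseteq> {0}}. {z. \<not> relations (pencil A C z) K \<subseteq> {0}})"
    by (intro finite_UN_I finite) (simp add: finite_dependent_rows_pencil)
  moreover have "finite (\<Union>G\<in>{G. relations_independent A G}. {z. \<not> relations_independent (pencil A C z) G})"
    by (intro finite_UN_I finite) (simp add: finite_dependent_relations_pencil)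
  moreover have "finite {z. \<not> relations_independent (pencil A C z) F}"
  proof -
    let ?S = "{w. \<not> relations_independent (pencil B (\<chi> p j. - C $ p $ j) w) F}"
    have "{z. \<not> relations_independent (pencil A C z) F} \<subseteq> (\<lambda>w. 1 - w) ` ?S"
    proof
      fix z assume "z \<in> {z. \<not> relations_independent (pencil A C z) F}"
      then have "1 - z \<in> ?S" unfolding reverse by simp
      then show "z \<in> (\<lambda>w. 1 - w) ` ?S" by (intro image_eqI[of _ _ "1 - z"]) simp_all
    qed
    moreover have "finite ?S" using B by (rule finite_dependent_relations_pencil)
    ultimately show ?thesis by (meson finite_imageI finite_subset)
  qed
  ultimately have "finite bad" unfolding bad_def by blast
  then obtain z where z: "z \<notin> bad"
    using ex_new_if_finite[OF infinite_UNIV_char_0[where 'a=complex]] by blast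
  have "central_generic (pencil A C z)"
    using cg z kn unfolding bad_def central_generic_iff[OF less_imp_le[OF kn]] by blast
  moreover have "relations_independent (pencil A C z) F" using z unfolding bad_def by blast
  moreover have "\<forall>G. relations_independent A G \<longrightarrow> relations_independent (pencil A C z) G"
    using z unfolding bad_def by blast
  ultimately show ?thesis by blast
qed

section \<open>Minimal dependent sets of circuits have surplus\<close>

lemma mem_D_hyp: "t \<in> D_hyp A L \<longleftrightarrow> (\<exists>x. \<forall>p\<in>L. (A *v x) $ p = t $ p)"
  by (auto simp: D_hyp_def hyp_def)

context
  fixes A :: "complex^'k^'n"
  assumes kn: "CARD('k) < CARD('n)" and cg: "central_generic A"
begin

text \<open>
  A relation inside \<open>W\<close> is determined by its coefficients outside a set of \<open>k\<close> independent rows.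
\<close>

lemma dim_relations_le:
  assumes "CARD('k) \<le> card W"
  shows "vec.dim (relations A W) + CARD('k) \<le> card W"
proof -
  obtain K where K: "K \<subseteq> W" "card K = CARD('k)" by (rule obtain_subset_with_card_n[OF assms])
  have "relations A W \<inter> coord K \<subseteq> {0}"
    using no_small_relations[OF kn cg K(2)] by (auto simp: relations_def)
  then have "vec.dim (relations A W \<inter> coord K) = 0" by (simp only: vec.dim_eq_0)
  then have "vec.dim (relations A W) + CARD('k)
      = vec.dim {a + b |a b. a \<in> relations A W \<and> b \<in> coord K}"
    using vec.dim_sums_Int[OF subspace_relations subspace_coord, of A W K]
    by (simp only: dim_coord K(2) add_0_right)
  also have "\<dots> \<le> vec.dim (coord W)"
    using coord_mono[OF K(1)]
    by (intro vec.dim_subset) (auto simp: relations_def intro: vec.subspace_add)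
  finally show ?thesis by simp
qed

lemma circuit_in_relations:
  assumes "card L = CARD('k) + 1" "L \<subseteq> W"
  shows "circuit A L \<in> relations A W"
  using circuit_relation[OF kn cg assms(1)] relations_mono[OF assms(2)] by blast

lemma surplus_if_indep:
  assumes G: "\<And>L. L \<in> G \<Longrightarrow> card L = CARD('k) + 1" "G \<noteq> {}" and ind: "indep_family (circuit A) G"
  shows "card G + CARD('k) \<le> card (\<Union>G)"
proof -
  obtain L where L: "L \<in> G" using G(2) by blast
  then have "card L \<le> card (\<Union>G)" by (intro card_mono) auto
  then have "CARD('k) \<le> card (\<Union>G)" using G(1)[OF L] by simp
  have "card G = card (circuit A ` G)" "vec.independent (circuit A ` G)"
    using ind card_image[of "circuit A" G] by (auto simp: indep_family_iff_independent)
  then have "card G \<le> vec.dim (relations A (\<Union>G))"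
    using vec.independent_card_le_dim[of "circuit A ` G" "relations A (\<Union>G)"]
      circuit_in_relations G(1) by (metis Union_upper image_subsetI)
  then show ?thesis using dim_relations_le[OF \<open>CARD('k) \<le> card (\<Union>G)\<close>] by linarith
qed

text \<open>
  If the surplus is missing, the circuits of \<open>C - {L}\<close> span all relations inside \<open>\<Union>C\<close>, so a translate
  lying in \<open>D_hyp A M\<close> for all \<open>M\<close> in \<open>C\<close> lies in \<open>D_hyp A N\<close> for every \<open>N \<subseteq> \<Union>C\<close> with \<open>k + 1\<close>
  elements.  Replacing one element of \<open>L\<close> by some \<open>h\<close> outside \<open>L\<close> gives such an \<open>N\<close>, and it puts the
  vertex of \<open>L\<close> on the hyperplane \<open>h\<close>.
\<close>

lemma surplus_minimal_dependent:
  assumes C: "\<And>L. L \<in> C \<Longrightarrow> card L = CARD('k) + 1"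
    and dep: "\<not> indep_family (circuit A) C" "\<forall>G. G \<subset> C \<longrightarrow> indep_family (circuit A) G"
    and t: "K_translated A C t"
  shows "card C + CARD('k) \<le> card (\<Union>C)"
proof (rule ccontr)
  let ?W = "\<Union>C"
  assume small: "\<not> card C + CARD('k) \<le> card ?W"
  have "circuit A L \<noteq> 0" if "L \<in> C" for L
  proof -
    have "L \<noteq> {}" using C[OF that] by auto
    then show ?thesis using circuit_nonzero[OF kn cg C[OF that]] by force
  qed
  then have "card C \<ge> 2" using card_dependent_ge_2[OF dep(1)] by simp
  then obtain L M where LM: "L \<in> C" "M \<in> C" "L \<noteq> M"
    using card_le_Suc0_iff_eq[of C] by fastforce
  have "card L \<le> card ?W" using LM(1) by (intro card_mono) auto
  then have kW: "CARD('k) \<le> card ?W" using C[OF LM(1)] by simp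
  have "\<not> M \<subseteq> L" using card_subset_eq[of L M] C LM by auto
  then obtain h where h: "h \<in> M" "h \<notin> L" by blast
  have ind: "indep_family (circuit A) (C - {L})" using dep(2) LM(1) by blast
  have "card (circuit A ` (C - {L})) = card C - 1"
    using ind LM(1) by (simp add: card_image indep_family_iff_independent)
  then have "vec.dim (relations A ?W) \<le> card (circuit A ` (C - {L}))"
    using small dim_relations_le[OF kW] by linarith
  moreover have "circuit A ` (C - {L}) \<subseteq> relations A ?W"
    using C by (auto intro!: circuit_in_relations)
  ultimately have span: "relations A ?W \<subseteq> vec.span (circuit A ` (C - {L}))"
    using ind by (intro vec.card_ge_dim_independent) (auto simp: indep_family_iff_independent)
  have tD: "t \<in> D_hyp A N" if "N \<in> C" for N
    using t that by (auto simp: K_translated_def D_hyp_def)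
  have vanish: "pairing c t = 0" if "c \<in> vec.span (circuit A ` (C - {L}))" for c
    using that
  proof (induction rule: vec.span_induct_alt)
    case (step a y z)
    then obtain N where N: "N \<in> C" "y = circuit A N" by blast
    then have "pairing y t = 0" using mem_D_hyp_iff_pairing[OF kn cg C] tD by blast
    then show ?case using step by simp
  qed simp
  obtain x where x: "\<forall>p\<in>L. (A *v x) $ p = t $ p" using tD[OF LM(1)] by (auto simp: mem_D_hyp)
  have "L \<noteq> {}" using C[OF LM(1)] by auto
  then obtain q where q: "q \<in> L" by blast
  let ?N = "insert h (L - {q})"
  have N: "card ?N = CARD('k) + 1" using h(2) q C[OF LM(1)] by simp
  have "?N \<subseteq> ?W" using LM h(1) by blast
  then have "pairing (circuit A ?N) t = 0" using circuit_in_relations[OF N] span vanish by blast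
  then have "t \<in> D_hyp A ?N" using mem_D_hyp_iff_pairing[OF kn cg N] by simp
  then obtain y where y: "\<forall>p\<in>?N. (A *v y) $ p = t $ p" by (auto simp: mem_D_hyp)
  have "x = y"
    by (rule common_point_unique[OF kn cg, of "L - {q}"]) (use x y q C[OF LM(1)] in auto)
  then have "x \<in> (\<Inter>p\<in>insert h L. hyp A t p)" using x y by (auto simp: hyp_def)
  then show False using t LM(1) h(2) unfolding K_translated_def by blast
qed

section \<open>Dependent arrangements are not very generic\<close>

text \<open>
  For independent circuits there is a direction \<open>d\<close> along which only the form with index \<open>L1\<close> in \<open>S\<close>
  changes.  All conditions that an almost \<open>K\<^sub>T\<close>-configuration has to satisfy besides the equations
  are inequations, affine in \<open>e\<close>, for the vertices \<open>x L + e *s y L\<close> of the translate \<open>t0 + e *s d\<close>,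
  so they survive for almost all \<open>e\<close>.  A second member \<open>L2\<close> of \<open>S\<close> fixes the amount by which the
  hyperplane \<open>l\<close> has to be translated, independently of \<open>e\<close>, while \<open>L1\<close> demands that it varies
  with \<open>e\<close>.
\<close>

lemma dependent_arr_dependent_circuits:
  assumes "dependent_arr A r s" "s > 1"
  shows "\<exists>T t. (\<forall>L\<in>T. card L = CARD('k) + 1) \<and> K_translated A T t \<and> \<not> indep_family (circuit A) T"
proof -
  from assms(1) obtain T l S t0 where rT: "r_set TYPE('k) r T"
    and S: "S \<subseteq> {L \<in> T. l \<in> L}" "card S = s"
    and t0: "almost_K_configuration A T l S t0"
    and all: "\<forall>t. almost_K_configuration A T l S t \<longrightarrow> (\<exists>c. K_translated A T (t + axis l c))"
    unfolding dependent_arr_def by (elim exE conjE) (rule that)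
  have T: "card L = CARD('k) + 1" if "L \<in> T" for L
    using rT that by (simp add: r_set_def)
  have ext: "\<exists>c. K_translated A T (t + axis l c)" if "almost_K_configuration A T l S t" for t
    using all that by simp
  obtain c0 where c0: "K_translated A T (t0 + axis l c0)" using ext[OF t0] by blast
  have "\<not> indep_family (circuit A) T"
  proof
    assume ind: "indep_family (circuit A) T"
    obtain L1 L2 where L12: "L1 \<in> S" "L2 \<in> S" "L1 \<noteq> L2"
      using card_le_Suc0_iff_eq[of S] S(2) assms(2) by fastforce
    then have LT: "L1 \<in> T" "L2 \<in> T" "l \<in> L1" "l \<in> L2" using S(1) by auto
    note D = mem_D_hyp_iff_pairing[OF kn cg T]
    obtain d where d: "d \<in> common_kernel (circuit A) (T - {L1})" "pairing (circuit A L1) d = 1"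
      using dual_vector_exists[OF ind LT(1)] by blast
    have vertex: "vertex A l S t L = {x. \<forall>p\<in>(if L \<in> S then L - {l} else L). (A *v x) $ p = t $ p}" for t L
      by (auto simp: vertex_def hyp_def)
    have vertex_exists: "\<exists>x. x \<in> vertex A l S t L" if "L \<in> T" "L \<notin> S \<Longrightarrow> t \<in> D_hyp A L" for t L
    proof (cases "L \<in> S")
      case True
      then have "card (L - {l}) = CARD('k)" using T[OF that(1)] S(1) by auto
      then show ?thesis using common_point_exists[OF kn cg] True by (simp add: vertex)
    next
      case False
      then show ?thesis using that(2) by (simp add: vertex mem_D_hyp)
    qed
    have vertex_unique: "x = y" if "L \<in> T" "x \<in> vertex A l S t L" "y \<in> vertex A l S t L" for x y t L
    proof (rule common_point_unique[OF kn cg])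
      show "CARD('k) \<le> card (if L \<in> S then L - {l} else L)"
        using T[OF that(1)] by (simp add: card_Diff_singleton_if)
    qed (use that(2,3) in \<open>auto simp: vertex\<close>)
    have t0D: "L \<notin> S \<Longrightarrow> t0 \<in> D_hyp A L" "L \<in> S \<Longrightarrow> t0 \<notin> D_hyp A L" if "L \<in> T" for L
      using t0 that by (auto simp: almost_K_configuration_def almost_K_translated_def D_hyp_def)
    have dD: "pairing (circuit A L) d = 0" if "L \<in> T" "L \<noteq> L1" for L
      using d(1) that by (auto simp: common_kernel_def)
    then have "L \<in> T \<Longrightarrow> L \<notin> S \<Longrightarrow> d \<in> D_hyp A L" for L using L12(1) D by blast
    then have "\<forall>L\<in>T. \<exists>y. y \<in> vertex A l S d L" using vertex_exists by blast
    from bchoice[OF this] obtain y where "\<forall>L\<in>T. y L \<in> vertex A l S d L" by (rule exE)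
    then have y: "\<And>L. L \<in> T \<Longrightarrow> y L \<in> vertex A l S d L" by simp
    have "\<forall>L\<in>T. \<exists>x. x \<in> vertex A l S t0 L" using vertex_exists t0D(1) by blast
    from bchoice[OF this] obtain x where "\<forall>L\<in>T. x L \<in> vertex A l S t0 L" by (rule exE)
    then have x: "\<And>L. L \<in> T \<Longrightarrow> x L \<in> vertex A l S t0 L" by simp
    have x_off: "(A *v x L) $ h - t0 $ h \<noteq> 0" if "L \<in> T" "h \<notin> L" "h \<noteq> l" for L h
      using t0 x[OF that(1)] that unfolding almost_K_configuration_def hyp_def by fastforce
    have x_apart: "(A *v x L) $ l - (A *v x M) $ l \<noteq> 0" if "L \<in> S" "M \<in> T" "l \<notin> M" for L M
    proof
      let ?c = "(A *v x L) $ l - t0 $ l"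
      have LT: "L \<in> T" using that(1) S(1) by blast
      assume "(A *v x L) $ l - (A *v x M) $ l = 0"
      then have "x L \<in> hyp A (t0 + axis l ?c) l" "x M \<in> hyp A (t0 + axis l ?c) l"
        by (auto simp: hyp_def)
      then show False
        using t0 x[OF LT] x[OF that(2)] that unfolding almost_K_configuration_def by blast
    qed
    \<comment> \<open>The second set preserves the failure at \<open>L1\<close>, the third keeps the vertices off the hyperplanes
      \<open>h \<noteq> l\<close>, and the last one keeps every parallel to the hyperplane \<open>l\<close> from meeting two vertices
      \<open>L\<close> and \<open>M\<close> that must stay apart.\<close>
    define bad where "bad = {0} \<union> {e. pairing (circuit A L1) t0 + e = 0} \<union>
      (\<Union>(L, h)\<in>{(L, h). L \<in> T \<and> h \<notin> L \<and> h \<noteq> l}.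
        {e. ((A *v x L) $ h - t0 $ h) + e * ((A *v y L) $ h - d $ h) = 0}) \<union>
      (\<Union>(L, M)\<in>{(L, M). L \<in> S \<and> M \<in> T \<and> l \<notin> M}.
        {e. ((A *v x L) $ l - (A *v x M) $ l) + e * ((A *v y L) $ l - (A *v y M) $ l) = 0})"
    have "pairing (circuit A L1) t0 \<noteq> 0" using t0D(2)[OF LT(1) L12(1)] D[OF LT(1)] by simp
    then have "finite {e. pairing (circuit A L1) t0 + e = 0}" using finite_affine_zeros[of _ 1] by simp
    then have "finite bad"
      unfolding bad_def using x_off x_apart
      by (intro finite_UnI finite_UN_I finite) (auto intro!: finite_affine_zeros simp del: right_minus_eq)
    then obtain e where e: "e \<notin> bad"
      using ex_new_if_finite[OF infinite_UNIV_char_0[where 'a=complex]] by blast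
    define t1 where "t1 = t0 + e *s d"
    have t1D: "pairing (circuit A L) t1 = pairing (circuit A L) t0 + (if L = L1 then e else 0)"
      if "L \<in> T" for L using dD[OF that] d(2) by (simp add: t1_def)
    have vertex_t1: "vertex A l S t1 L = {x L + e *s y L}" if L: "L \<in> T" for L
    proof -
      have "x L + e *s y L \<in> vertex A l S t1 L"
        using x[OF L] y[OF L]
        by (auto simp: vertex t1_def matrix_vector_right_distrib vec.scale split: if_splits)
      then show ?thesis using vertex_unique[OF L] by blast
    qed
    have "almost_K_configuration A T l S t1"
      unfolding almost_K_configuration_def almost_K_translated_def
    proof (intro conjI ballI allI impI)
      fix L assume L: "L \<in> T - S"
      then have "t1 \<in> D_hyp A L" using t0D(1)[of L] D[of L] t1D[of L] L12(1) by auto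
      then show "(\<Inter>p\<in>L. hyp A t1 p) \<noteq> {}" by (simp add: D_hyp_def)
    next
      fix L assume L: "L \<in> S"
      then have LT: "L \<in> T" using S(1) by blast
      have "t1 \<notin> D_hyp A L"
        using t0D(2)[OF LT L] e D[OF LT] t1D[OF LT] by (auto simp: bad_def)
      then show "(\<Inter>p\<in>L. hyp A t1 p) = {}" by (simp add: D_hyp_def)
    next
      fix L h assume L: "L \<in> T" and h: "h \<notin> L \<and> h \<noteq> l"
      have "((A *v x L) $ h - t0 $ h) + e * ((A *v y L) $ h - d $ h) \<noteq> 0"
        using e L h unfolding bad_def by blast
      then have "x L + e *s y L \<notin> hyp A t1 h"
        by (auto simp: hyp_def t1_def matrix_vector_right_distrib vec.scale algebra_simps)
      then show "vertex A l S t1 L \<inter> hyp A t1 h = {}" by (simp add: vertex_t1[OF L])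
    next
      fix L M c assume L: "L \<in> S" and M: "M \<in> T" "l \<notin> M"
      then have LT: "L \<in> T" using S(1) by blast
      have "((A *v x L) $ l - (A *v x M) $ l) + e * ((A *v y L) $ l - (A *v y M) $ l) \<noteq> 0"
        using e L M unfolding bad_def by blast
      then have "(A *v (x L + e *s y L)) $ l \<noteq> (A *v (x M + e *s y M)) $ l"
        by (auto simp: matrix_vector_right_distrib vec.scale algebra_simps)
      then show "vertex A l S t1 L \<inter> hyp A (t1 + axis l c) l = {} \<or>
          vertex A l S t1 M \<inter> hyp A (t1 + axis l c) l = {}"
        unfolding vertex_t1[OF LT] vertex_t1[OF M(1)] by (auto simp: hyp_def)
    qed
    then obtain c1 where c1: "K_translated A T (t1 + axis l c1)" using ext by blast
    have K: "pairing (circuit A L) t + circuit A L $ l * c = 0"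
      if "K_translated A T (t + axis l c)" "L \<in> T" for t c L
    proof -
      have "t + axis l c \<in> D_hyp A L" using that by (auto simp: K_translated_def D_hyp_def)
      then show ?thesis using D[OF that(2)] by simp
    qed
    have "circuit A L2 $ l * c1 = circuit A L2 $ l * c0"
      using K[OF c0 LT(2)] K[OF c1 LT(2)] t1D[OF LT(2)] L12(3) by (simp add: add_eq_0_iff)
    then have "c1 = c0" using circuit_nonzero[OF kn cg T[OF LT(2)] LT(4)] by simp
    then have "e = 0" using K[OF c0 LT(1)] K[OF c1 LT(1)] t1D[OF LT(1)] by (simp add: add_eq_0_iff)
    then show False using e by (simp add: bad_def)
  qed
  then show ?thesis using T c0 by blast
qed

end

theorem theorem3p8:
  fixes A :: "complex^'k^'n" and r s :: nat
  assumes "CARD('k) \<ge> 2" and "CARD('n) > CARD('k)"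
    and "central_generic A"
    and "dependent_arr A r s" and "s > 1"
  shows "\<not> very_generic A"
proof
  assume vg: "very_generic A"
  note kn = assms(2) and cg = assms(3)
  let ?E = "{L :: 'n set. card L = CARD('k) + 1}"
  obtain T t where T: "T \<subseteq> ?E" "K_translated A T t" "\<not> indep_family (circuit A) T"
    using dependent_arr_dependent_circuits[OF kn cg assms(4,5)] by blast
  obtain C where C: "C \<subseteq> T" "\<not> indep_family (circuit A) C" "\<forall>G. G \<subset> C \<longrightarrow> indep_family (circuit A) G"
    using minimal_dependent_subset[OF finite T(3)] by blast
  have CE: "L \<in> C \<Longrightarrow> card L = CARD('k) + 1" for L using C(1) T(1) by blast
  have t: "K_translated A C t" using T(2) C(1) by (auto simp: K_translated_def)
  have "card G + CARD('k) \<le> card (\<Union>G)" if G: "G \<subseteq> C" "G \<noteq> {}" for G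
  proof (cases "G = C")
    case True
    then show ?thesis using surplus_minimal_dependent[OF kn cg CE C(2,3) t] by simp
  next
    case False
    then have "indep_family (circuit A) G" using C(3) G(1) by blast
    then show ?thesis using surplus_if_indep[OF kn cg, of G] CE G by blast
  qed
  then obtain B :: "complex^'k^'n" where "relations_independent B C"
    using independent_relations_exist[where 'k='k, of C] CE by blast
  then obtain A' :: "complex^'k^'n" where A': "central_generic A'" "relations_independent A' C"
    "\<And>G. relations_independent A G \<Longrightarrow> relations_independent A' G"
    using generic_perturbation[OF kn cg] by blast
  have "card (common_kernel (circuit A) ` Pow ?E) < card (common_kernel (circuit A') ` Pow ?E)"
  proof (rule card_common_kernels_less)
    show "indep_family (circuit A') F" if "F \<subseteq> ?E" "indep_family (circuit A) F" for F
    proof -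
      have F: "L \<in> F \<Longrightarrow> card L = CARD('k) + 1" for L using that(1) by blast
      show ?thesis
        using A'(3) that(2) relations_independent_iff[OF kn cg F] relations_independent_iff[OF kn A'(1) F]
        by blast
    qed
    show "circuit A L \<noteq> 0" if L: "L \<in> ?E" for L
    proof -
      have "L \<noteq> {}" using L by auto
      then show ?thesis using circuit_nonzero[OF kn cg, of L] L by force
    qed
    show "indep_family (circuit A') C" using A'(2) relations_independent_iff[OF kn A'(1) CE] by blast
    show "C \<subseteq> ?E" using CE by blast
  qed (use C(2) in simp_all)
  then have "card (intersection_lattice A) < card (intersection_lattice A')"
    by (simp only: intersection_lattice_eq[OF kn cg] intersection_lattice_eq[OF kn A'(1)])
  then show False using vg A'(1) by (auto simp: very_generic_def not_le[symmetric])
qed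

end
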